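(* The regular atoms of the map $L^{\rm in}$ are the half-open quadrilaterals $\Lambda_n^{\rm in}$, $n=1,\dots,N-1$. That is, each $\Lambda_n^{\rm in}$ is an atom of $L^{\rm in}$. For each $n$, the atom $\Lambda_n^{\rm in}$ is invariant under $L^{\rm in}$, with return symbolic dynamics $(1^{4(n-1)})$ (so its transit time is $4(n-1)$). The set of fixed points of the restriction $L_n^{\rm in}$ of $L^{\rm in}$ to $\Lambda_n^{\rm in}$ is the segment connecting the vertex $Q_1(n)$ to the opposite vertex $Q_0(n-1)$. There are at most five other atoms of $L^{\rm in}$, of total area $O(\lambda^3)$ as $\lambda\to0^+$.
   Context: Let $0<\lambda<\lambda_+$, where $\lambda_+=2\cos(4\pi/9)\approx0.347$ (a root of $x^3-3x+1$). Let $\Omega=[0,1)^2$, $F:\Omega\to\Omega$, $F(x,y)=(\lambda x-y+\iota(x,y),x)$, $\iota(x,y)=-\lfloor\lambda x-y\rfloor\in\{0,1\}$, and $G(x,y)=(y,x)$; $F$ is a bijection and $F^{-1}=G\circ F\circ G$. Let $\mathcal Q(U,V)=U_xV_x+U_yV_y-\frac\lambda2(U_xV_y+U_yV_x)$; isometries and areas refer to this metric. Put $\theta=\arcsin(\lambda/2)$. Let $c=(\frac1{2-\lambda},\frac1{2-\lambda})$ (fixed point of $F$) and let $\mathcal E$ be the ellipse $\mathcal Q(z-c,z-c)=(1-\lambda^2/4)(\frac{1-\lambda}{2-\lambda})^2$, tangent to $y=1$ at $T_0=(\frac{1+\lambda}2,1)$ and to $x=1$ at $G(T_0)$. $\Sigma$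 is the open region near the corner $(1,1)$ bounded by the segments $[T_0,(1,1)]$, $[(1,1),G(T_0)]$ and the arc of $\mathcal E$ from $T_0$ clockwise to $G(T_0)$. Put $\Lambda=\Sigma\setminus F^4(\Sigma)$. For $z\in\Lambda$ let $\bar L^{\rm in}(z)=F^t(z)$, where the transit time $t=t(z)\ge0$ is minimal such that $F^t(z)\in G(\Lambda)$ (defined up to measure zero), and let $L^{\rm in}=G\circ\bar L^{\rm in}:\Lambda\to\Lambda$. The return symbolic dynamics of $z$ is the word $(\iota(z),\iota(F(z)),\dots,\iota(F^{t-1}(z)))$; the exponent in $(1^k)$ denotes repetition. An atom of $L^{\rm in}$ is a maximal connected subset of $\Lambda$ on which transit time and return symbolic dynamics are constant. Let $N=\lfloor\frac1{4(1-4\rho)}-\frac14\rfloor$ with $\rho=\frac1{2\pi}\arccos(\lambda/2)$ (so $N=\lfloor\frac{\pi}{8\theta}-\frac14\rfloor$). For $n\ge0$ let $\ell_n$ be the image of the line $y=1$ under $z\mapsto c+C^{4n}(z-c)$, $C=\begin{pmatrix}\lambda&-1\\1&0\end{pmatrix}$ (thus $\ell_n$ is tangent to $\mathcal E$), and put $Q_0(n)=\ell_0\cap G(\ell_n)$, $Q_1(n)=\ell_1\cap G(\ell_n)$. For $1\le n\le N-1$, $\Lambda_n^{\rm in}\subset\Lambda$ is the convex quadrilateral with consecutive vertices $Q_0(n),Q_0(n-1),Q_1(n-1),Q_1(n)$, where the sides lying on $\ell_1$ (i.e. $[Q_1(n-1),Q_1(n)]$) and on $G(\ell_n)$ (i.e.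 $[Q_0(n),Q_1(n)]$) belong to $\Lambda_n^{\rm in}$, while the sides lying on $\ell_0$ and on $G(\ell_{n-1})$ do not (in these prescriptions endpoints of sides are disregarded). Segments such as the fixed set are understood up to endpoints. *)

theory Defs
  imports "HOL-Analysis.Analysis" "HOL-Library.Landau_Symbols"
begin

type_synonym plane = "real \<times> real"

definition iota :: "real \<Rightarrow> plane \<Rightarrow> int" where
  "iota lam z = - \<lfloor>lam * fst z - snd z\<rfloor>"

text \<open>The map is given by its formula on the whole plane; only its values on the
  invariant square [0,1) x [0,1) are ever used.\<close>

definition F :: "real \<Rightarrow> plane \<Rightarrow> plane" where
  "F lam z = (lam * fst z - snd z + of_int (iota lam z), fst z)"

definition G :: "plane \<Rightarrow> plane" where
  "G z = (snd z, fst z)"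

definition C :: "real \<Rightarrow> plane \<Rightarrow> plane" where
  "C lam z = (lam * fst z - snd z, fst z)"

definition Qform :: "real \<Rightarrow> plane \<Rightarrow> plane \<Rightarrow> real" where
  "Qform lam u v = fst u * fst v + snd u * snd v
     - lam / 2 * (fst u * snd v + snd u * fst v)"

text \<open>Area for the metric \<^const>\<open>Qform\<close>: its Gram matrix has determinant 1 - lam^2/4.\<close>

definition Qarea :: "real \<Rightarrow> plane set \<Rightarrow> real" where
  "Qarea lam A = sqrt (1 - lam^2 / 4) * measure lebesgue A"

definition centre :: "real \<Rightarrow> plane" where
  "centre lam = (1 / (2 - lam), 1 / (2 - lam))"

definition radius2 :: "real \<Rightarrow> real" where
  "radius2 lam = (1 - lam^2 / 4) * ((1 - lam) / (2 - lam))^2"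

definition T0 :: "real \<Rightarrow> plane" where
  "T0 lam = ((1 + lam) / 2, 1)"

text \<open>The sides [T0, (1,1)] and [(1,1), G T0] are tangent to the ellipse at T0 and G T0, so
  the short arc from T0 to G T0 lies in the triangle T0, (1,1), G T0. The open region bounded
  by the two sides and the arc is the open triangle with the closed elliptic disc removed.\<close>

definition Sector :: "real \<Rightarrow> plane set" where
  "Sector lam = interior (convex hull {T0 lam, (1, 1), G (T0 lam)})
     - {z. Qform lam (z - centre lam) (z - centre lam) \<le> radius2 lam}"

definition Lam :: "real \<Rightarrow> plane set" where
  "Lam lam = Sector lam - (F lam ^^ 4) ` Sector lam"

definition Lin_dom :: "real \<Rightarrow> plane set" where
  "Lin_dom lam = {z \<in> Lam lam. \<exists>t. (F lam ^^ t) z \<in> G ` Lam lam}"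

definition transit :: "real \<Rightarrow> plane \<Rightarrow> nat" where
  "transit lam z = (LEAST t. (F lam ^^ t) z \<in> G ` Lam lam)"

definition Lin :: "real \<Rightarrow> plane \<Rightarrow> plane" where
  "Lin lam z = G ((F lam ^^ transit lam z) z)"

definition ret_word :: "real \<Rightarrow> plane \<Rightarrow> int list" where
  "ret_word lam z = map (\<lambda>i. iota lam ((F lam ^^ i) z)) [0..<transit lam z]"

definition const_return :: "real \<Rightarrow> plane set \<Rightarrow> bool" where
  "const_return lam S \<longleftrightarrow> S \<subseteq> Lin_dom lam \<and>
     (\<forall>z\<in>S. \<forall>w\<in>S. transit lam z = transit lam w \<and> ret_word lam z = ret_word lam w)"

definition atoms :: "real \<Rightarrow> plane set set" where
  "atoms lam = {A. A \<noteq> {} \<and> connected A \<and> const_return lam A \<and>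
     (\<forall>B. A \<subseteq> B \<and> connected B \<and> const_return lam B \<longrightarrow> B = A)}"

definition rho :: "real \<Rightarrow> real" where
  "rho lam = arccos (lam / 2) / (2 * pi)"

definition NN :: "real \<Rightarrow> nat" where
  "NN lam = nat \<lfloor>1 / (4 * (1 - 4 * rho lam)) - 1 / 4\<rfloor>"

definition rot4 :: "real \<Rightarrow> nat \<Rightarrow> plane \<Rightarrow> plane" where
  "rot4 lam n z = centre lam + (C lam ^^ (4 * n)) (z - centre lam)"

definition ell :: "real \<Rightarrow> nat \<Rightarrow> plane set" where
  "ell lam n = rot4 lam n ` {z. snd z = 1}"

text \<open>Vertices Q i n, the intersection of the lines ell i and G (ell n). When
  pi / (8 * arcsin (lam / 2)) - 1/4 is an integer, the lines ell 1 and G (ell (NN - 1)) coincide;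
  their intersection is then read as their common point of tangency with the ellipse, which is
  the limit of the intersection points.\<close>

definition Qpt :: "real \<Rightarrow> nat \<Rightarrow> nat \<Rightarrow> plane" where
  "Qpt lam i n = (if ell lam i = G ` ell lam n then rot4 lam i (T0 lam)
     else (THE p. p \<in> ell lam i \<inter> G ` ell lam n))"

definition vertices :: "real \<Rightarrow> nat \<Rightarrow> plane set" where
  "vertices lam n = {Qpt lam 0 n, Qpt lam 0 (n - 1), Qpt lam 1 (n - 1), Qpt lam 1 n}"

text \<open>The half-open quadrilateral: the sides on ell 0 and on G (ell (n - 1)) are removed, those
  on ell 1 and on G (ell n) are kept. Membership of the four vertices is immaterial; they are
  left out.\<close>

definition Lam_in :: "real \<Rightarrow> nat \<Rightarrow> plane set" where
  "Lam_in lam n = convex hull (vertices lam n)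
     - closed_segment (Qpt lam 0 n) (Qpt lam 0 (n - 1))
     - closed_segment (Qpt lam 0 (n - 1)) (Qpt lam 1 (n - 1))
     - vertices lam n"

definition is_Lam_in :: "real \<Rightarrow> nat \<Rightarrow> plane set \<Rightarrow> bool" where
  "is_Lam_in lam n A \<longleftrightarrow> A - vertices lam n = Lam_in lam n"

definition other_atoms :: "real \<Rightarrow> plane set set" where
  "other_atoms lam = {A \<in> atoms lam. \<not> (\<exists>n\<in>{1..NN lam - 1}. is_Lam_in lam n A)}"

end

theory Submission
  imports Defs
begin

text \<open>For the metric Q the ellipse is a circle and \<open>C\<close> is the rotation by
\<open>\<alpha> = arccos (\<lambda>/2) = \<pi>/2 - \<theta>\<close>. A point outside a circle is determined by the angles
\<open>a < b\<close> at which the two tangents through it touch, and in these coordinates everything becomes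
elementary. Measure angles from \<open>G T0\<close>, so that \<open>T0\<close> has angle \<open>\<alpha>\<close>, and put
\<open>\<tau> = 2\<pi> - 4\<alpha> = 4\<theta>\<close>. The sector is the triangle \<open>0 < a < b < \<alpha>\<close> (\<open>Sector_eq\<close>), the swap \<open>G\<close> is
\<open>(a, b) \<mapsto> (\<alpha> - b, \<alpha> - a)\<close>, and rotation by \<open>C\<close> adds \<open>\<alpha>\<close> to both coordinates.

\<open>F\<close> agrees with the rotation about the centre as long as the rotated point stays to the left of
\<open>x = 1\<close>, which is the tangent at angle 0. Starting in the sector this always holds for three steps. At
the fourth it holds unless \<open>a \<le> \<tau> \<le> b\<close>, and then the point is thrown to the opposite side of
the square (\<open>F4_meet\<close>, \<open>meet_shift_not_in_Sector\<close>). So while an orbit of \<open>F^4\<close> remains in the sector it is translated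
by \<open>-\<tau>\<close>; the entrance set is \<open>Lam = {b \<ge> \<alpha> - \<tau>}\<close>, the exit set is \<open>G Lam = {a \<le> \<tau>}\<close>, and a point
with \<open>k\<tau> < a \<le> (k+1)\<tau>\<close> leaves after exactly \<open>k\<close> rounds, with all symbols equal to 1.

Hence the atoms are the cells \<open>k\<tau> < a \<le> (k+1)\<tau>\<close> of \<open>Lam\<close>: distinct cells have distinct transit
times, and each is connected, being the continuous image of a convex set (\<open>atoms_eq\<close>). Moreover
\<open>N = \<lfloor>\<alpha>/\<tau>\<rfloor>\<close>. For \<open>k + 2 \<le> N\<close> the cell is a full rectangle in the coordinates \<open>a, b\<close>. The coordinate
lines are tangent lines, so in the plane it is the half-open quadrilateral with \<open>n = k + 1\<close>
(\<open>Lam_in_eq\<close>). The return map there is \<open>(a, b) \<mapsto> (\<alpha> - b + k\<tau>, \<alpha> - a + k\<tau>)\<close>, a reflection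
preserving the rectangle and fixing its diagonal \<open>a + b = \<alpha> + k\<tau>\<close>, a segment of a ray from the centre.
Only the cells \<open>k = N - 1\<close> and \<open>k = N\<close> are left. There \<open>a\<close> and \<open>b\<close> are within \<open>2\<tau>\<close> of \<open>\<alpha>\<close>, so
they lie in a box at \<open>T0\<close> of width \<open>O(\<tau>)\<close> and, because \<open>y = 1\<close> is tangent there, of height
\<open>O(\<tau>\<^sup>2)\<close>; and \<open>\<tau> = O(\<lambda>)\<close>.\<close>

section \<open>Angles of tangency as coordinates\<close>

lemma cos_less_cos:
  fixes t d :: real
  assumes "0 \<le> d" "d < \<bar>t\<bar>" "\<bar>t\<bar> < 2 * pi - d"
  shows "cos t < cos d"
proof (cases "\<bar>t\<bar> \<le> pi")
  case True
  then show ?thesis using assms cos_monotone_0_pi[of d "\<bar>t\<bar>"] by simp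
next
  case False
  have "cos (2 * pi - \<bar>t\<bar>) < cos d"
    using assms False by (intro cos_monotone_0_pi) auto
  then show ?thesis by (simp add: cos_diff)
qed

lemma cos_le_cos:
  fixes t d :: real
  assumes "\<bar>t\<bar> \<le> d" "d \<le> pi"
  shows "cos d \<le> cos t"
  using assms cos_monotone_0_pi_le[of "\<bar>t\<bar>" d] by simp

text \<open>The angle of the rotation \<open>C\<close> in the metric Q.\<close>

definition angle :: "real \<Rightarrow> real" where
  "angle lam = arccos (lam / 2)"

text \<open>Four steps of the rotation fall short of a full turn by this angle, which is \<open>4\<theta>\<close>.\<close>

definition drift :: "real \<Rightarrow> real" where
  "drift lam = 2 * pi - 4 * angle lam"

text \<open>The Euclidean distance of the centre from the lines \<open>x = 1\<close> and \<open>y = 1\<close>; the first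
  coordinate of the centre is \<open>1 - scale\<close>.\<close>

definition scale :: "real \<Rightarrow> real" where
  "scale lam = (1 - lam) / (2 - lam)"

text \<open>The point where the tangents to the ellipse at the angles \<open>a\<close> and \<open>b\<close> meet: in the metric Q it lies in
  direction \<open>(a + b)/2\<close>, at \<open>1 / cos ((b - a)/2)\<close> radii from the centre. The coordinates x and y are, up
  to scaling, the projections to the directions \<open>0\<close> and \<open>\<alpha>\<close>. For \<open>a = b\<close> it is the point of tangency.\<close>

definition meet :: "real \<Rightarrow> real \<Rightarrow> real \<Rightarrow> plane" where
  "meet lam a b =
     (1 - scale lam + scale lam * (cos ((a + b) / 2) / cos ((b - a) / 2)),
      1 - scale lam + scale lam * (cos (angle lam - (a + b) / 2) / cos ((b - a) / 2)))"

text \<open>The projection to direction \<open>psi\<close>, in units of the radius. It takes the value 1 on the tangent at angle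
  \<open>psi\<close> and exceeds 1 exactly on the far side of that tangent.\<close>

definition supp :: "real \<Rightarrow> real \<Rightarrow> plane \<Rightarrow> real" where
  "supp lam psi z =
     (sin (angle lam - psi) * (fst z - (1 - scale lam))
        + sin psi * (snd z - (1 - scale lam))) / (scale lam * sin (angle lam))"

lemma meet_commute: "meet lam a b = meet lam b a"
proof -
  have "cos ((b - a) / 2) = cos ((a - b) / 2)"
    using cos_minus[of "(b - a) / 2"] by (simp add: minus_divide_left)
  then show ?thesis by (simp add: meet_def add.commute)
qed

lemma G_meet: "G (meet lam a b) = meet lam (angle lam - b) (angle lam - a)"
proof -
  have eq: "(angle lam - b + (angle lam - a)) / 2 = angle lam - (a + b) / 2"
    "(angle lam - a - (angle lam - b)) / 2 = (b - a) / 2"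
    by (simp_all add: field_simps)
  show ?thesis unfolding meet_def G_def eq by simp
qed

lemma G_G [simp]: "G (G z) = z"
  by (simp add: G_def)

text \<open>The bound \<open>\<lambda> < 1\<close> keeps the ellipse nondegenerate and
  \<open>\<alpha>\<close> between \<open>\<pi>/3\<close> and \<open>\<pi>/2\<close>.\<close>

locale rotation =
  fixes lam :: real
  assumes lam_pos: "0 < lam" and lam_less_1: "lam < 1"
begin

abbreviation "alpha \<equiv> angle lam"
abbreviation "tau \<equiv> drift lam"
abbreviation "kappa \<equiv> scale lam"

lemma cos_alpha: "cos alpha = lam / 2"
  using lam_pos lam_less_1 by (simp add: angle_def)

lemma alpha_less: "alpha < pi / 2"
proof -
  have "arccos (lam / 2) < arccos 0"
    using lam_pos lam_less_1 by (intro arccos_less_arccos) auto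
  then show ?thesis by (simp add: angle_def)
qed

lemma alpha_greater: "pi / 3 < alpha"
proof -
  have "arccos (1 / 2) < arccos (lam / 2)"
    using lam_pos lam_less_1 by (intro arccos_less_arccos) auto
  moreover have "arccos (1 / 2) = pi / 3"
    using arccos_cos[of "pi / 3"] pi_gt_zero by (simp add: cos_60)
  ultimately show ?thesis by (simp add: angle_def)
qed

lemma alpha_pos: "0 < alpha"
  using alpha_greater pi_gt_zero by linarith

lemma tau_pos: "0 < tau"
  using alpha_less by (simp add: drift_def)

lemma four_alpha: "4 * alpha = 2 * pi - tau"
  by (simp add: drift_def)

lemma tau_less: "tau < 2 * pi / 3"
  using alpha_greater by (simp add: drift_def)

lemmas angle_bounds = alpha_pos alpha_less alpha_greater tau_pos tau_less

lemma sin_alpha_pos: "0 < sin alpha"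
  using angle_bounds by (intro sin_gt_zero) auto

lemma kappa_pos: "0 < kappa" and kappa_less: "2 * kappa < 1"
  using lam_pos lam_less_1 by (auto simp: scale_def field_simps)

lemma centre_eq: "centre lam = (1 - kappa, 1 - kappa)"
  using lam_less_1 by (simp add: centre_def scale_def field_simps)

text \<open>Through this formula every incidence between points and tangents becomes a comparison of two cosines.\<close>

lemma supp_meet: "supp lam psi (meet lam a b) = cos (psi - (a + b) / 2) / cos ((b - a) / 2)"
proof -
  define m where "m = (a + b) / 2"
  define d where "d = cos ((b - a) / 2)"
  have "sin (alpha - psi) * cos m + sin psi * cos (alpha - m) = sin alpha * cos (psi - m)"
    by (simp add: sin_diff cos_diff algebra_simps)
  moreover have "supp lam psi (meet lam a b)
      = (sin (alpha - psi) * cos m + sin psi * cos (alpha - m)) / (sin alpha * d)"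
    using kappa_pos sin_alpha_pos
    by (simp add: supp_def meet_def m_def d_def divide_simps)
       (simp add: algebra_simps)
  ultimately show ?thesis
    using sin_alpha_pos by (simp add: m_def d_def)
qed

lemma supp_0: "supp lam 0 z = (fst z - (1 - kappa)) / kappa"
  and supp_alpha: "supp lam alpha z = (snd z - (1 - kappa)) / kappa"
  using sin_alpha_pos by (simp_all add: supp_def)

lemma fst_less_1_iff: "fst z < 1 \<longleftrightarrow> supp lam 0 z < 1"
  and snd_less_1_iff: "snd z < 1 \<longleftrightarrow> supp lam alpha z < 1"
  using kappa_pos by (simp_all add: supp_0 supp_alpha field_simps)

text \<open>A tangent has the point on its far side precisely when its angle lies between the two tangency angles.
  Angles matter only modulo \<open>2\<pi>\<close>, hence the two windows for \<open>psi\<close>.\<close>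

lemma supp_meet_less_1:
  assumes "a \<le> b" "b < a + pi" "b < psi \<and> psi < a + 2 * pi \<or> b - 2 * pi < psi \<and> psi < a"
  shows "supp lam psi (meet lam a b) < 1"
proof -
  have pos: "0 < cos ((b - a) / 2)"
    using assms by (intro cos_gt_zero_pi) auto
  have "cos (psi - (a + b) / 2) < cos ((b - a) / 2)"
    using assms by (intro cos_less_cos) (auto simp: abs_if field_simps split: if_splits)
  then show ?thesis using pos by (simp add: supp_meet)
qed

lemma supp_meet_ge_1:
  assumes "a \<le> psi" "psi \<le> b" "b < a + pi"
  shows "1 \<le> supp lam psi (meet lam a b)"
proof -
  have pos: "0 < cos ((b - a) / 2)"
    using assms by (intro cos_gt_zero_pi) auto
  have "cos ((b - a) / 2) \<le> cos (psi - (a + b) / 2)"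
    using assms by (intro cos_le_cos) (auto simp: abs_if field_simps split: if_splits)
  then show ?thesis using pos by (simp add: supp_meet)
qed

lemma supp_meet_eq_1:
  assumes "a \<le> b" "b < a + pi"
  shows "supp lam a (meet lam a b) = 1" "supp lam b (meet lam a b) = 1"
proof -
  have pos: "0 < cos ((b - a) / 2)"
    using assms by (intro cos_gt_zero_pi) auto
  have eq: "a - (a + b) / 2 = - ((b - a) / 2)" "b - (a + b) / 2 = (b - a) / 2"
    by (simp_all add: field_simps)
  have "cos (a - (a + b) / 2) = cos ((b - a) / 2)" "cos (b - (a + b) / 2) = cos ((b - a) / 2)"
    unfolding eq by simp_all
  then show "supp lam a (meet lam a b) = 1" "supp lam b (meet lam a b) = 1"
    using pos by (simp_all add: supp_meet)
qed

text \<open>If \<open>a < a'\<close>, a tangent with angle just above \<open>a\<close> has the first point beyond it and the second one not.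
  The window conditions make the coordinates unambiguous modulo \<open>2\<pi>\<close>; the case \<open>a' = b'\<close> of a point on the
  ellipse is included because a vertex of the last quadrilateral can be such a point.\<close>

lemma meet_eq_imp_left_le:
  assumes "meet lam a b = meet lam a' b'"
    "a < b" "b < a + pi" "a' \<le> b'" "b' < a' + pi" "b' - 2 * pi < a"
  shows "a' \<le> a"
proof (rule ccontr)
  assume "\<not> a' \<le> a"
  then obtain psi where psi: "a < psi" "psi < min a' b"
    using assms dense[of a "min a' b"] by auto
  have "1 \<le> supp lam psi (meet lam a b)"
    using psi assms by (intro supp_meet_ge_1) auto
  moreover have "supp lam psi (meet lam a' b') < 1"
    using psi assms by (intro supp_meet_less_1) auto
  ultimately show False using assms(1) by simp
qed

lemma meet_eq_imp_right_le:
  assumes "meet lam a b = meet lam a' b'"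
    "a < b" "b < a + pi" "a' \<le> b'" "b' < a' + pi" "b < a' + 2 * pi"
  shows "b \<le> b'"
proof (rule ccontr)
  assume "\<not> b \<le> b'"
  then obtain psi where psi: "max a b' < psi" "psi < b"
    using assms dense[of "max a b'" b] by auto
  have "1 \<le> supp lam psi (meet lam a b)"
    using psi assms by (intro supp_meet_ge_1) auto
  moreover have "supp lam psi (meet lam a' b') < 1"
    using psi assms by (intro supp_meet_less_1) auto
  ultimately show False using assms(1) by simp
qed

lemma meet_inj:
  assumes "meet lam a b = meet lam a' b'"
    "a < b" "b < a + pi" "a' < b'" "b' < a' + pi" "b' - 2 * pi < a" "b - 2 * pi < a'"
  shows "a = a'" "b = b'"
  using meet_eq_imp_left_le[of a b a' b'] meet_eq_imp_left_le[of a' b' a b]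
    meet_eq_imp_right_le[of a b a' b'] meet_eq_imp_right_le[of a' b' a b] assms
  by auto

lemma supp_eqI:
  assumes "supp lam 0 z = supp lam 0 w" "supp lam alpha z = supp lam alpha w"
  shows "z = w"
  using assms kappa_pos by (simp add: supp_0 supp_alpha prod_eq_iff)

text \<open>In an orthonormal frame for Q the functional is the inner product with the unit vector at angle \<open>psi\<close>.\<close>

lemma supp_linear:
  "supp lam psi z = supp lam 0 z * cos psi
     + (supp lam alpha z - supp lam 0 z * cos alpha) / sin alpha * sin psi"
  using sin_alpha_pos kappa_pos
  by (simp add: supp_def sin_diff divide_simps) (simp add: algebra_simps)

lemma radius2_eq: "radius2 lam = (kappa * sin alpha)\<^sup>2"
  by (simp add: radius2_def scale_def power_mult_distrib sin_squared_eq cos_alpha power_divide)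

lemma Qform_supp:
  "Qform lam (z - centre lam) (z - centre lam)
     = kappa\<^sup>2 * ((supp lam 0 z)\<^sup>2 + (supp lam alpha z)\<^sup>2
         - 2 * cos alpha * supp lam 0 z * supp lam alpha z)"
proof -
  have "fst (z - centre lam) = kappa * supp lam 0 z" "snd (z - centre lam) = kappa * supp lam alpha z"
    using kappa_pos by (simp_all add: supp_0 supp_alpha centre_eq)
  then show ?thesis
    by (simp add: Qform_def cos_alpha power2_eq_square algebra_simps)
qed

lemma Qform_polar:
  assumes "\<And>psi. supp lam psi z = r * cos (psi - m)"
  shows "Qform lam (z - centre lam) (z - centre lam) = radius2 lam * r\<^sup>2"
proof -
  have trig: "(cos m)\<^sup>2 + (cos (alpha - m))\<^sup>2 - 2 * cos alpha * cos m * cos (alpha - m)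
      = (sin alpha)\<^sup>2"
    using sin_cos_squared_add[of m] sin_cos_squared_add[of alpha] unfolding cos_diff
    by algebra
  have "Qform lam (z - centre lam) (z - centre lam)
      = kappa\<^sup>2 * r\<^sup>2 * ((cos m)\<^sup>2 + (cos (alpha - m))\<^sup>2 - 2 * cos alpha * cos m * cos (alpha - m))"
    unfolding Qform_supp assms by (simp add: power2_eq_square algebra_simps)
  also have "\<dots> = radius2 lam * r\<^sup>2"
    by (simp only: trig radius2_eq) (simp add: power_mult_distrib)
  finally show ?thesis .
qed

text \<open>Polar coordinates about the centre. The reference angle \<open>phi\<close> selects the window of length \<open>2\<pi>\<close> in which
  the direction is chosen.\<close>

lemma supp_polar:
  obtains m r where "\<bar>m - phi\<bar> \<le> pi" "0 \<le> r" "\<And>psi. supp lam psi z = r * cos (psi - m)"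
proof -
  define u where "u = supp lam 0 z"
  define v where "v = (supp lam alpha z - supp lam 0 z * cos alpha) / sin alpha"
  define w where "w = Complex u v * cis (- phi)"
  define m where "m = phi + Arg w"
  define r where "r = cmod w"
  have "Complex u v = w * cis phi"
    by (simp add: w_def mult.assoc cis_mult)
  also have "w = rcis r (Arg w)"
    by (simp add: r_def rcis_cmod_Arg)
  also have "rcis r (Arg w) * cis phi = rcis r m"
    by (simp add: m_def rcis_def cis_mult add.commute mult.assoc)
  finally have uv: "u = r * cos m" "v = r * sin m"
    by (auto simp: complex_eq_iff)
  have supp: "supp lam psi z = r * cos (psi - m)" for psi
    using uv supp_linear[of psi z] by (simp add: u_def v_def cos_diff algebra_simps)
  show thesis
    by (rule that[of m r]) (use supp Arg_bounded[of w] in \<open>auto simp: m_def r_def\<close>)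
qed

text \<open>The tangents through a point at \<open>r \<ge> 1\<close> radii in direction \<open>m\<close> touch at \<open>m \<plusminus> d\<close> with \<open>cos d = 1/r\<close>.\<close>

lemma polar_imp_meet:
  assumes "1 \<le> r" "\<And>psi. supp lam psi z = r * cos (psi - m)"
  obtains d where "0 \<le> d" "d < pi / 2" "r = 1 / cos d" "z = meet lam (m - d) (m + d)"
proof -
  define d where "d = arccos (1 / r)"
  have bnds: "- 1 < 1 / r" "0 < 1 / r" "1 / r \<le> 1"
    using assms(1) by (auto simp: divide_simps)
  have d: "0 \<le> d" "cos d = 1 / r"
    using arccos_lbound[OF less_imp_le[OF bnds(1)] bnds(3)]
      cos_arccos[OF less_imp_le[OF bnds(1)] bnds(3)] by (simp_all only: d_def)
  have "d < pi / 2"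
    using arccos_less_arccos[of 0 "1 / r"] bnds by (simp add: d_def)
  moreover have "supp lam psi z = supp lam psi (meet lam (m - d) (m + d))" for psi
    using d by (simp add: supp_meet assms(2))
  then have "z = meet lam (m - d) (m + d)"
    by (intro supp_eqI) auto
  ultimately show thesis
    using that d assms(1) by auto
qed

lemma radius2_pos: "0 < radius2 lam"
  using kappa_pos sin_alpha_pos by (simp add: radius2_eq)

subsection \<open>The sector\<close>

lemma interior_triangle:
  "interior (convex hull {T0 lam, (1, 1), G (T0 lam)})
     = {z. fst z < 1 \<and> snd z < 1 \<and> 2 - (1 - lam) / 2 < fst z + snd z}"
proof -
  define h where "h = (1 - lam) / 2"
  have h: "0 < h" using lam_less_1 by (simp add: h_def)
  have T0: "T0 lam = (1 - h, 1)" "G (T0 lam) = (1, 1 - h)"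
    by (simp_all add: T0_def G_def h_def field_simps)
  have nc: "\<not> collinear {(1 - h, 1::real), (1, 1), (1, 1 - h)}"
  proof
    assume "collinear {(1 - h, 1::real), (1, 1), (1, 1 - h)}"
    then consider "(1 - h, 1::real) = (1, 1 - h)"
      | u where "(1::real, 1::real) = u *\<^sub>R (1 - h, 1) + (1 - u) *\<^sub>R (1, 1 - h)"
      unfolding collinear_3_expand by blast
    then show False
    proof cases
      case 1
      then show False using h by simp
    next
      case (2 u)
      then have u: "1 = u * (1 - h) + (1 - u)" "1 = u + (1 - u) * (1 - h)"
        by (simp_all add: prod_eq_iff)
      have "u * h = 0" "(1 - u) * h = 0"
        using u by (simp_all add: algebra_simps)
      then show False using h by simp
    qed
  qed
  have "z \<in> interior (convex hull {(1 - h, 1::real), (1, 1), (1, 1 - h)}) \<longleftrightarrow>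
      fst z < 1 \<and> snd z < 1 \<and> 2 - h < fst z + snd z" for z
  proof -
    have "z \<in> interior (convex hull {(1 - h, 1::real), (1, 1), (1, 1 - h)}) \<longleftrightarrow>
        (\<exists>x y w. 0 < x \<and> 0 < y \<and> 0 < w \<and> x + y + w = 1 \<and> z = (1 - x * h, 1 - w * h))"
    proof -
      have "x *\<^sub>R (1 - h, 1::real) + y *\<^sub>R (1, 1) + w *\<^sub>R (1, 1 - h) = (1 - x * h, 1 - w * h)"
        if "x + y + w = 1" for x y w
      proof -
        have y: "y = 1 - x - w" using that by simp
        show ?thesis unfolding y by (simp add: algebra_simps)
      qed
      then have "(x + y + w = 1 \<and> x *\<^sub>R (1 - h, 1::real) + y *\<^sub>R (1, 1) + w *\<^sub>R (1, 1 - h) = z)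
          \<longleftrightarrow> (x + y + w = 1 \<and> z = (1 - x * h, 1 - w * h))" for x y w
        by auto
      moreover have "DIM(real \<times> real) = 2" by simp
      ultimately show ?thesis
        by (simp only: interior_convex_hull_3_minimal[OF nc] mem_Collect_eq)
    qed
    also have "\<dots> \<longleftrightarrow> fst z < 1 \<and> snd z < 1 \<and> 2 - h < fst z + snd z"
      (is "?L \<longleftrightarrow> ?R")
    proof
      assume ?L
      then obtain x y w where xyw: "0 < x" "0 < y" "0 < w" "x + y + w = 1"
        and z: "z = (1 - x * h, 1 - w * h)" by blast
      have "(x + w) * h < 1 * h"
        using xyw h by (intro mult_strict_right_mono) auto
      moreover have "0 < x * h" "0 < w * h"
        using xyw h by auto
      ultimately show ?R by (simp add: z distrib_right)
    next
      assume z: ?R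
      define x w where "x = (1 - fst z) / h" and "w = (1 - snd z) / h"
      have "x * h = 1 - fst z" "w * h = 1 - snd z"
        using h by (simp_all add: x_def w_def)
      then have "z = (1 - x * h, 1 - w * h)" "(x + w) * h < 1 * h"
        using z by (simp_all add: prod_eq_iff distrib_right)
      moreover have "0 < x" "0 < w"
        using z h by (simp_all add: x_def w_def)
      moreover have "x + w < 1"
        using \<open>(x + w) * h < 1 * h\<close> h by (rule mult_right_less_imp_less[OF _ less_imp_le])
      moreover have "x + (1 - x - w) + w = 1" by simp
      ultimately show ?L
        by (metis add_diff_cancel_left' diff_diff_eq diff_gt_0_iff_gt)
    qed
    finally show ?thesis .
  qed
  then show ?thesis
    unfolding T0(2) unfolding T0(1) h_def[symmetric] by (intro set_eqI) simp
qed

text \<open>The last condition says that the point is beyond the chord from \<open>T0\<close> to \<open>G T0\<close>, whose normal has the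
  direction \<open>\<alpha>/2\<close>.\<close>

lemma sector_iff_polar:
  assumes supp: "\<And>psi. supp lam psi z = r * cos (psi - m)" and "0 \<le> r"
  shows "z \<in> Sector lam \<longleftrightarrow> 1 < r \<and> r * cos m < 1 \<and> r * cos (alpha - m) < 1
    \<and> cos (alpha / 2) < r * cos (alpha / 2 - m)"
proof -
  have half: "0 < cos (alpha / 2)"
    using angle_bounds by (intro cos_gt_zero) auto
  have "(1 - lam) / 2 = kappa * (1 - cos alpha)"
    using lam_less_1 by (simp add: scale_def cos_alpha divide_simps)
  then have "2 - (1 - lam) / 2 = 2 - 2 * kappa + kappa * (1 + cos alpha)"
    by (simp add: algebra_simps)
  moreover have "1 + cos alpha = 2 * cos (alpha / 2) * cos (alpha / 2)"
    using cos_double_cos[of "alpha / 2"] by (simp add: power2_eq_square)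
  ultimately have "2 - (1 - lam) / 2
      = 2 - 2 * kappa + 2 * kappa * cos (alpha / 2) * cos (alpha / 2)"
    by simp
  moreover have "fst z + snd z
      = 2 - 2 * kappa + 2 * kappa * cos (alpha / 2) * (r * cos (alpha / 2 - m))"
  proof -
    have "fst z + snd z = 2 - 2 * kappa + kappa * (supp lam 0 z + supp lam alpha z)"
      using kappa_pos by (simp add: supp_0 supp_alpha distrib_left)
    moreover have "cos (0 - m) + cos (alpha - m) = 2 * cos (alpha / 2 - m) * cos (alpha / 2)"
      using cos_plus_cos[of "alpha - m" "0 - m"] by (simp add: diff_divide_distrib add.commute)
    then have "supp lam 0 z + supp lam alpha z = r * (2 * cos (alpha / 2 - m) * cos (alpha / 2))"
      unfolding supp distrib_left[symmetric] by simp
    ultimately show ?thesis by simp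
  qed
  ultimately have chord: "2 - (1 - lam) / 2 < fst z + snd z
      \<longleftrightarrow> cos (alpha / 2) < r * cos (alpha / 2 - m)"
    using half kappa_pos by simp
  have "Qform lam (z - centre lam) (z - centre lam) \<le> radius2 lam \<longleftrightarrow> r\<^sup>2 \<le> 1"
    using radius2_pos by (simp add: Qform_polar[OF supp])
  also have "\<dots> \<longleftrightarrow> r \<le> 1"
    using power2_le_iff_abs_le[of 1 r] assms(2) by simp
  finally have disc: "Qform lam (z - centre lam) (z - centre lam) \<le> radius2 lam \<longleftrightarrow> r \<le> 1" .
  have sides: "fst z < 1 \<longleftrightarrow> r * cos m < 1" "snd z < 1 \<longleftrightarrow> r * cos (alpha - m) < 1"
    unfolding fst_less_1_iff snd_less_1_iff supp by simp_all
  show ?thesis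
    unfolding Sector_def interior_triangle Diff_iff mem_Collect_eq chord disc sides
    by (auto simp: not_le)
qed

text \<open>Both sides \<open>x = 1\<close> and \<open>y = 1\<close> are tangents, so not being beyond them keeps \<open>0\<close> and \<open>\<alpha>\<close> out of the
  interval \<open>[a, b]\<close>; that the interval lies between them, and not elsewhere on the circle, is due to the
  chord.\<close>

lemma Sector_eq: "Sector lam = {meet lam a b |a b. 0 < a \<and> a < b \<and> b < alpha}"
proof (intro equalityI subsetI)
  fix z assume z: "z \<in> Sector lam"
  obtain m r where m: "\<bar>m - alpha / 2\<bar> \<le> pi" and r: "0 \<le> r"
    and supp: "\<And>psi. supp lam psi z = r * cos (psi - m)"
    using supp_polar[of "alpha / 2" z] by metis
  have *: "1 < r" "r * cos m < 1" "r * cos (alpha - m) < 1" "cos (alpha / 2) < r * cos (alpha / 2 - m)"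
    using z sector_iff_polar[OF supp r] by auto
  obtain d where d: "0 \<le> d" "d < pi / 2" "r = 1 / cos d" "z = meet lam (m - d) (m + d)"
    using polar_imp_meet[of r z m] supp * by auto
  have cd: "0 < cos d" using d by (intro cos_gt_zero_pi) auto
  have dpos: "0 < d"
  proof (rule ccontr)
    assume "\<not> 0 < d"
    then have "d = 0" using d(1) by linarith
    then have "r = 1" using d(3) by simp
    then show False using *(1) by simp
  qed
  have far: "d < \<bar>m\<bar>" "d < \<bar>alpha - m\<bar>"
    using *(2,3) cos_le_cos[of m d] cos_le_cos[of "alpha - m" d] d cd
    by (force simp: divide_less_eq)+
  have chord: "cos (alpha / 2) * cos d < cos (alpha / 2 - m)"
    using * cd d by (simp add: field_simps)
  have *: "0 < cos (alpha / 2)" "0 < sin (alpha / 2)" "0 < sin d"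
    using angle_bounds dpos d by (auto intro!: cos_gt_zero sin_gt_zero)
  then have "cos (alpha / 2 + d) < cos (alpha / 2) * cos d"
    by (simp add: cos_add)
  then have "cos (alpha / 2 + d) < cos (alpha / 2 - m)" using chord by simp
  moreover have "cos (alpha / 2 - m) \<le> cos (alpha / 2 + d)" if "alpha / 2 + d \<le> \<bar>alpha / 2 - m\<bar>"
  proof -
    have "cos \<bar>alpha / 2 - m\<bar> \<le> cos (alpha / 2 + d)"
      using that m d(1) alpha_pos by (intro cos_monotone_0_pi_le) linarith+
    then show ?thesis by simp
  qed
  ultimately have "\<bar>alpha / 2 - m\<bar> < alpha / 2 + d"
    by (meson leD leI)
  then have "0 < m - d" "m + d < alpha"
    using far by linarith+
  then show "z \<in> {meet lam a b |a b. 0 < a \<and> a < b \<and> b < alpha}"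
    using d(4) dpos by (intro CollectI exI[of _ "m - d"] exI[of _ "m + d"]) simp
next
  fix z assume "z \<in> {meet lam a b |a b. 0 < a \<and> a < b \<and> b < alpha}"
  then obtain a b where z: "z = meet lam a b" and ab: "0 < a" "a < b" "b < alpha" by auto
  define m where "m = (a + b) / 2"
  define d where "d = (b - a) / 2"
  have d: "0 < d" "d < pi / 2" "d < m" "m + d < alpha"
    using ab angle_bounds by (auto simp: m_def d_def field_simps)
  have cd: "0 < cos d" "cos d < 1"
    using d cos_monotone_0_pi[of 0 d] by (auto intro!: cos_gt_zero)
  have "cos m < cos d" "cos (alpha - m) < cos d"
    using d angle_bounds by (auto intro!: cos_less_cos)
  moreover have "cos (alpha / 2) * cos d < cos (alpha / 2 - m)"
  proof -
    have "cos (alpha / 2) * cos d < cos (alpha / 2 - d)"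
      using d angle_bounds by (simp add: cos_diff sin_gt_zero)
    also have "\<dots> \<le> cos (alpha / 2 - m)"
      using d angle_bounds by (intro cos_le_cos[of "alpha / 2 - m" "alpha / 2 - d", simplified]) auto
    finally show ?thesis .
  qed
  moreover have "supp lam psi z = 1 / cos d * cos (psi - m)" for psi
    by (simp add: z supp_meet m_def d_def)
  ultimately show "z \<in> Sector lam"
    using cd by (subst sector_iff_polar[of z "1 / cos d" m]) (auto simp: field_simps)
qed

lemma meet_in_Sector: "0 < a \<Longrightarrow> a < b \<Longrightarrow> b < alpha \<Longrightarrow> meet lam a b \<in> Sector lam"
  unfolding Sector_eq by blast

section \<open>The dynamics in tangent coordinates\<close>

text \<open>The right-hand side is the value of \<open>F\<close> when \<open>iota = 1\<close>.\<close>

lemma meet_rotate: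
  "meet lam (a + alpha) (b + alpha) = (lam * fst (meet lam a b) - snd (meet lam a b) + 1, fst (meet lam a b))"
proof -
  define m where "m = (a + b) / 2"
  define d where "d = cos ((b - a) / 2)"
  have eq: "(a + alpha + (b + alpha)) / 2 = m + alpha" "(b + alpha - (a + alpha)) / 2 = (b - a) / 2"
    by (simp_all add: m_def field_simps)
  have "kappa * (2 - lam) = 1 - lam"
    using lam_less_1 by (simp add: scale_def)
  then have fixed: "lam * (1 - kappa) + kappa = 1 - kappa"
    by (simp add: algebra_simps)
  have "cos (m + alpha) = lam * cos m - cos (alpha - m)"
    using cos_alpha by (simp add: cos_add cos_diff)
  then have "cos (m + alpha) / d = lam * (cos m / d) - cos (alpha - m) / d"
    by (simp add: diff_divide_distrib)
  then have "1 - kappa + kappa * (cos (m + alpha) / d) =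
      lam * (1 - kappa + kappa * (cos m / d)) - (1 - kappa + kappa * (cos (alpha - m) / d)) + 1"
    using fixed by algebra
  then show ?thesis
    unfolding meet_def eq m_def[symmetric] d_def[symmetric] by simp
qed

lemma meet_periodic: "meet lam (a + 2 * pi) (b + 2 * pi) = meet lam a b"
proof -
  have eq: "(a + 2 * pi + (b + 2 * pi)) / 2 = (a + b) / 2 + 2 * pi"
    "alpha - (a + 2 * pi + (b + 2 * pi)) / 2 = alpha - (a + b) / 2 - 2 * pi"
    "(b + 2 * pi - (a + 2 * pi)) / 2 = (b - a) / 2"
    by (simp_all add: field_simps)
  show ?thesis
    unfolding meet_def eq by (simp add: cos_diff)
qed

lemma meet_rotate4: "meet lam (a + 4 * alpha) (b + 4 * alpha) = meet lam (a - tau) (b - tau)"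
proof -
  have eq: "a - tau + 2 * pi = a + 4 * alpha" "b - tau + 2 * pi = b + 4 * alpha"
    by (simp_all add: four_alpha)
  show ?thesis using meet_periodic[of "a - tau" "b - tau"] unfolding eq .
qed

lemma F_unit_square:
  assumes "z \<in> {0..<1} \<times> {0..<1}"
  shows "F lam z \<in> {0..<1} \<times> {0..<1}"
  using assms of_int_floor_le[of "lam * fst z - snd z"]
    real_of_int_floor_add_one_gt[of "lam * fst z - snd z"]
  by (simp only: F_def iota_def mem_Times_iff fst_conv snd_conv atLeastLessThan_iff of_int_minus)
     (intro conjI TrueI; linarith)

text \<open>In the unit square \<open>iota\<close> is decided by whether the rotated point has its abscissa below 1, that is, by the
  tangent at angle 0.\<close>

lemma
  assumes "meet lam a b \<in> {0..<1} \<times> {0..<1}"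
  shows iota_meet: "iota lam (meet lam a b)
      = (if supp lam 0 (meet lam (a + alpha) (b + alpha)) < 1 then 1 else 0)"
    and F_meet: "F lam (meet lam a b) = meet lam (a + alpha) (b + alpha)
      - (if supp lam 0 (meet lam (a + alpha) (b + alpha)) < 1 then 0 else (1, 0))"
proof -
  define x y where "x = fst (meet lam a b)" and "y = snd (meet lam a b)"
  have xy: "0 \<le> x" "x < 1" "0 \<le> y" "y < 1"
    using assms by (auto simp: x_def y_def mem_Times_iff)
  \<comment> \<open>Since lam x - y lies in (-1, 1), its sign alone decides the floor.\<close>
  have "lam * x \<le> 1 * x"
    using xy lam_less_1 by (intro mult_right_mono) auto
  then have "lam * x < 1" using xy by simp
  moreover have "0 \<le> lam * x" using xy lam_pos by simp
  ultimately have "\<lfloor>lam * x - y\<rfloor> = (if lam * x - y < 0 then -1 else 0)"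
    using xy by (auto simp: floor_eq_iff)
  moreover have "supp lam 0 (meet lam (a + alpha) (b + alpha)) < 1 \<longleftrightarrow> lam * x - y < 0"
    unfolding fst_less_1_iff[symmetric] meet_rotate by (auto simp: x_def y_def)
  ultimately show "iota lam (meet lam a b)
      = (if supp lam 0 (meet lam (a + alpha) (b + alpha)) < 1 then 1 else 0)"
    by (simp add: iota_def x_def y_def)
  then show "F lam (meet lam a b) = meet lam (a + alpha) (b + alpha)
      - (if supp lam 0 (meet lam (a + alpha) (b + alpha)) < 1 then 0 else (1, 0))"
    by (simp add: F_def meet_rotate)
qed

lemma meet_in_corner:
  assumes "0 < a" "a < b" "b < alpha"
  shows "meet lam a b \<in> {1 / 2<..<1} \<times> {1 / 2<..<1}"
proof -
  have "0 < cos ((a + b) / 2)"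
    using assms angle_bounds by (intro cos_gt_zero_pi; simp add: field_simps)
  moreover have "0 < cos (alpha - (a + b) / 2)"
    using assms angle_bounds by (intro cos_gt_zero_pi; simp add: field_simps)
  moreover have "0 < cos ((b - a) / 2)"
    using assms angle_bounds by (intro cos_gt_zero_pi; simp add: field_simps)
  moreover have "supp lam 0 (meet lam a b) < 1" "supp lam alpha (meet lam a b) < 1"
    using assms angle_bounds by (auto intro!: supp_meet_less_1)
  ultimately have "fst (meet lam a b) < 1" "snd (meet lam a b) < 1"
    "1 - kappa < fst (meet lam a b)" "1 - kappa < snd (meet lam a b)"
    using kappa_pos unfolding fst_less_1_iff[symmetric] snd_less_1_iff[symmetric]
    by (simp_all add: meet_def)
  then show ?thesis
    using kappa_less by (simp add: mem_Times_iff)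
qed

text \<open>During the first three steps the interval \<open>[a + j\<alpha>, b + j\<alpha>]\<close> stays inside \<open>(0, 2\<pi>)\<close>, so the tangent at
  angle 0 is not met.\<close>

lemma
  assumes "0 < a" "a < b" "b < alpha" "j \<le> 3"
  shows F_iter_meet: "(F lam ^^ j) (meet lam a b) = meet lam (a + real j * alpha) (b + real j * alpha)"
    and F_iter_meet_unit_square: "(F lam ^^ j) (meet lam a b) \<in> {0..<1} \<times> {0..<1}"
    and iota_iter_meet: "j < 3 \<Longrightarrow> iota lam ((F lam ^^ j) (meet lam a b)) = 1"
proof -
  have small: "supp lam 0 (meet lam (a + real (Suc i) * alpha) (b + real (Suc i) * alpha)) < 1"
    if "i < 3" for i
  proof (rule supp_meet_less_1)
    have "real (Suc i) * alpha \<le> 3 * alpha" "0 \<le> real (Suc i) * alpha"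
      using that alpha_pos mult_right_mono[of "real (Suc i)" 3 alpha] by auto
    then show "b + real (Suc i) * alpha < 0 \<and> 0 < a + real (Suc i) * alpha + 2 * pi \<or>
        b + real (Suc i) * alpha - 2 * pi < 0 \<and> 0 < a + real (Suc i) * alpha"
      using assms angle_bounds by linarith
  qed (use assms angle_bounds in auto)
  have main: "(F lam ^^ i) (meet lam a b) = meet lam (a + real i * alpha) (b + real i * alpha) \<and>
      (F lam ^^ i) (meet lam a b) \<in> {0..<1} \<times> {0..<1}" if "i \<le> 3" for i
    using that
  proof (induction i)
    case 0
    then show ?case using meet_in_corner[OF assms(1-3)] by (auto simp: mem_Times_iff)
  next
    case (Suc i)
    then have "i \<le> 3" by simp
    have IH: "(F lam ^^ i) (meet lam a b) = meet lam (a + real i * alpha) (b + real i * alpha)"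
      "(F lam ^^ i) (meet lam a b) \<in> {0..<1} \<times> {0..<1}"
      using Suc.IH[OF \<open>i \<le> 3\<close>] by blast+
    have "F lam (meet lam (a + real i * alpha) (b + real i * alpha))
        = meet lam (a + real (Suc i) * alpha) (b + real (Suc i) * alpha)"
      using F_meet[OF IH(2)[unfolded IH(1)]] small[of i] Suc.prems
      by (simp add: algebra_simps)
    then show ?case
      using IH F_unit_square[OF IH(2)] by simp
  qed
  show "(F lam ^^ j) (meet lam a b) = meet lam (a + real j * alpha) (b + real j * alpha)"
    "(F lam ^^ j) (meet lam a b) \<in> {0..<1} \<times> {0..<1}"
    using main[OF assms(4)] by blast+
  show "iota lam ((F lam ^^ j) (meet lam a b)) = 1" if "j < 3"
  proof -
    have at_j: "(F lam ^^ j) (meet lam a b) = meet lam (a + real j * alpha) (b + real j * alpha)"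
      "(F lam ^^ j) (meet lam a b) \<in> {0..<1} \<times> {0..<1}"
      using main[OF assms(4)] by blast+
    show ?thesis
      using iota_meet[OF at_j(2)[unfolded at_j(1)]] small[OF that] at_j(1)
      by (simp add: algebra_simps)
  qed
qed

text \<open>After the fourth step the interval is \<open>[a - \<tau>, b - \<tau>]\<close> modulo \<open>2\<pi>\<close>, which may contain 0.\<close>

lemma
  assumes "0 < a" "a < b" "b < alpha"
  shows iota_F3_meet: "iota lam ((F lam ^^ 3) (meet lam a b)) = (if a \<le> tau \<and> tau \<le> b then 0 else 1)"
    and F4_meet: "(F lam ^^ 4) (meet lam a b)
      = meet lam (a - tau) (b - tau) - (if a \<le> tau \<and> tau \<le> b then (1, 0) else 0)"
proof -
  have F3: "(F lam ^^ 3) (meet lam a b) = meet lam (a + 3 * alpha) (b + 3 * alpha)"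
    "(F lam ^^ 3) (meet lam a b) \<in> {0..<1} \<times> {0..<1}"
    using F_iter_meet[OF assms, of 3] F_iter_meet_unit_square[OF assms, of 3] by auto
  have rot: "meet lam (a + 3 * alpha + alpha) (b + 3 * alpha + alpha) = meet lam (a - tau) (b - tau)"
    using meet_rotate4[of a b] by (simp add: algebra_simps)
  have "supp lam 0 (meet lam (a - tau) (b - tau)) < 1 \<longleftrightarrow> \<not> (a \<le> tau \<and> tau \<le> b)"
  proof (cases "a \<le> tau \<and> tau \<le> b")
    case True
    then have "1 \<le> supp lam 0 (meet lam (a - tau) (b - tau))"
      using assms angle_bounds by (intro supp_meet_ge_1) auto
    then show ?thesis using True by auto
  next
    case False
    then have "supp lam 0 (meet lam (a - tau) (b - tau)) < 1"
      using assms angle_bounds by (intro supp_meet_less_1) auto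
    then show ?thesis using False by auto
  qed
  then have test: "supp lam 0 (meet lam (a + 3 * alpha + alpha) (b + 3 * alpha + alpha)) < 1
      \<longleftrightarrow> \<not> (a \<le> tau \<and> tau \<le> b)"
    unfolding rot .
  show "iota lam ((F lam ^^ 3) (meet lam a b)) = (if a \<le> tau \<and> tau \<le> b then 0 else 1)"
    using iota_meet[of "a + 3 * alpha" "b + 3 * alpha"] F3 unfolding test by auto
  have "(F lam ^^ 4) (meet lam a b) = F lam ((F lam ^^ 3) (meet lam a b))"
    by (simp add: numeral_eq_Suc)
  then show "(F lam ^^ 4) (meet lam a b)
      = meet lam (a - tau) (b - tau) - (if a \<le> tau \<and> tau \<le> b then (1, 0) else 0)"
    using F_meet[of "a + 3 * alpha" "b + 3 * alpha"] F3 unfolding test unfolding rot by auto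
qed

text \<open>The bounds on \<open>a\<close> and \<open>b\<close> cover the positions reached during one round, where a full turn cannot bring the
  point back to the sector.\<close>

lemma meet_in_Sector_iff:
  assumes "a < b" "b < a + pi" "alpha - 2 * pi \<le> a" "b \<le> 2 * pi"
  shows "meet lam a b \<in> Sector lam \<longleftrightarrow> 0 < a \<and> b < alpha"
proof
  assume "meet lam a b \<in> Sector lam"
  then obtain a' b' where "meet lam a b = meet lam a' b'" "0 < a'" "a' < b'" "b' < alpha"
    by (auto simp: Sector_eq)
  then show "0 < a \<and> b < alpha"
    using meet_inj[of a b a' b'] assms angle_bounds by auto
qed (use assms in \<open>auto simp: Sector_eq\<close>)

text \<open>The sector lies to the right of the centre. Before the shift the abscissa exceeds that of the centre by
  at most twice the scale, which is less than 1, so afterwards the point is to the left of the centre.\<close>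

lemma meet_shift_not_in_Sector:
  assumes "0 < a" "a < b" "b < alpha" "a \<le> tau" "tau \<le> b"
  shows "meet lam (a - tau) (b - tau) - (1, 0) \<notin> Sector lam"
proof
  assume "meet lam (a - tau) (b - tau) - (1, 0) \<in> Sector lam"
  then have "1 / 2 < fst (meet lam (a - tau) (b - tau) - (1, 0))"
    using meet_in_corner unfolding Sector_eq by (fastforce simp: mem_Times_iff)
  then have "3 / 2 < 1 - kappa + kappa * supp lam 0 (meet lam (a - tau) (b - tau))"
    using kappa_pos by (simp add: supp_0)
  moreover have "supp lam 0 (meet lam (a - tau) (b - tau)) \<le> 2"
  proof -
    have eq: "(b - tau - (a - tau)) / 2 = (b - a) / 2" by simp
    have "cos (pi / 3) \<le> cos ((b - a) / 2)"
      using assms angle_bounds by (intro cos_monotone_0_pi_le) auto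
    then have "1 / 2 \<le> cos ((b - a) / 2)" by (simp add: cos_60)
    moreover have "cos (0 - (a - tau + (b - tau)) / 2) \<le> 1" by simp
    ultimately show ?thesis
      unfolding supp_meet eq by (subst pos_divide_le_eq; linarith)
  qed
  then have "kappa * supp lam 0 (meet lam (a - tau) (b - tau)) \<le> kappa * 2"
    using kappa_pos by (intro mult_left_mono) auto
  ultimately show False using kappa_less by linarith
qed

text \<open>A point of the sector is the image under \<open>F^4\<close> of the point with both coordinates larger by \<open>\<tau>\<close>, provided
  that this is in the sector too. It has no other preimage there, since the shifted images miss the sector.\<close>

lemma meet_in_Lam_iff:
  assumes "0 < a" "a < b" "b < alpha"
  shows "meet lam a b \<in> Lam lam \<longleftrightarrow> alpha - tau \<le> b"
proof -
  have sec: "meet lam a b \<in> Sector lam"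
    using assms by (auto simp: Sector_eq)
  have "meet lam a b \<in> (F lam ^^ 4) ` Sector lam \<longleftrightarrow> b < alpha - tau"
  proof
    assume "b < alpha - tau"
    then have "meet lam (a + tau) (b + tau) \<in> Sector lam"
      "(F lam ^^ 4) (meet lam (a + tau) (b + tau)) = meet lam a b"
      using assms tau_pos F4_meet[of "a + tau" "b + tau"] by (auto intro!: meet_in_Sector)
    then show "meet lam a b \<in> (F lam ^^ 4) ` Sector lam" by (metis imageI)
  next
    assume "meet lam a b \<in> (F lam ^^ 4) ` Sector lam"
    then obtain a' b' where ab': "0 < a'" "a' < b'" "b' < alpha"
      and eq: "meet lam a b = (F lam ^^ 4) (meet lam a' b')"
      by (auto simp: Sector_eq)
    have "\<not> (a' \<le> tau \<and> tau \<le> b')"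
      using eq sec F4_meet[OF ab'] meet_shift_not_in_Sector[OF ab'] by auto
    then have "meet lam a b = meet lam (a' - tau) (b' - tau)"
      using eq F4_meet[OF ab'] by auto
    then have "b = b' - tau"
      using meet_inj[of a b "a' - tau" "b' - tau"] assms ab' angle_bounds by auto
    then show "b < alpha - tau" using ab' by simp
  qed
  then show ?thesis using sec by (auto simp: Lam_def)
qed

lemma Lam_eq: "Lam lam = {meet lam a b |a b. 0 < a \<and> a < b \<and> alpha - tau \<le> b \<and> b < alpha}"
proof -
  have "Lam lam \<subseteq> Sector lam" by (auto simp: Lam_def)
  then show ?thesis
    using meet_in_Lam_iff unfolding Sector_eq by blast
qed

lemma G_Lam_subset_Sector: "G ` Lam lam \<subseteq> Sector lam"
  unfolding Lam_eq Sector_eq by (force simp: G_meet)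

lemma meet_in_G_Lam_iff:
  assumes "0 < a" "a < b" "b < alpha"
  shows "meet lam a b \<in> G ` Lam lam \<longleftrightarrow> a \<le> tau"
proof -
  have "meet lam a b \<in> G ` Lam lam \<longleftrightarrow> G (meet lam a b) \<in> Lam lam"
    by (metis G_G image_iff)
  also have "\<dots> \<longleftrightarrow> a \<le> tau"
    using assms unfolding G_meet by (subst meet_in_Lam_iff) auto
  finally show ?thesis .
qed

lemma mult_tau_nonneg: "0 \<le> real k * tau"
  using tau_pos by simp

lemma F_iter_4_mult_meet:
  assumes "real k * tau < a" "a < b" "b < alpha"
  shows "(F lam ^^ (4 * k)) (meet lam a b) = meet lam (a - real k * tau) (b - real k * tau)"
  using assms
proof (induction k)
  case (Suc k)
  define a' b' where "a' = a - real k * tau" and "b' = b - real k * tau"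
  have step: "real (Suc k) * tau = real k * tau + tau"
    by (simp add: algebra_simps)
  have "real k * tau < a"
    using Suc.prems(1) tau_pos unfolding step by linarith
  then have IH: "(F lam ^^ (4 * k)) (meet lam a b) = meet lam a' b'"
    unfolding a'_def b'_def using Suc.prems(2,3) by (rule Suc.IH)
  have ab': "tau < a'" "a' < b'" "b' < alpha"
    using Suc.prems mult_tau_nonneg[of k] unfolding a'_def b'_def step by linarith+
  have "(F lam ^^ (4 * Suc k)) (meet lam a b) = (F lam ^^ 4) ((F lam ^^ (4 * k)) (meet lam a b))"
    by (simp only: mult_Suc_right funpow_add comp_apply)
  also note IH
  also have "(F lam ^^ 4) (meet lam a' b') = meet lam (a' - tau) (b' - tau)"
    using F4_meet[of a' b'] ab' tau_pos by simp
  also have "\<dots> = meet lam (a - real (Suc k) * tau) (b - real (Suc k) * tau)"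
    unfolding a'_def b'_def step by (simp add: diff_diff_eq)
  finally show ?case .
qed simp

text \<open>Before the exit the points at multiples of 4 still have \<open>a > \<tau>\<close>, and in between the orbit is outside the
  sector.\<close>

lemma F_iter_iota_meet:
  assumes "real k * tau < a" "a < b" "b < alpha" "i < 4 * k"
  shows "(F lam ^^ i) (meet lam a b) \<notin> G ` Lam lam" "iota lam ((F lam ^^ i) (meet lam a b)) = 1"
proof -
  \<comment> \<open>q counts the completed rounds and j the steps of the current one.\<close>
  define q j where "q = i div 4" and "j = i mod 4"
  have i: "i = j + 4 * q" and j: "j \<le> 3" and q: "q < k"
    using assms by (auto simp: q_def j_def)
  define a' b' where "a' = a - real q * tau" and "b' = b - real q * tau"
  have "real q * tau + tau \<le> real k * tau"
    using q tau_pos mult_right_mono[of "real q + 1" "real k" tau] by (simp add: algebra_simps)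
  moreover have "0 \<le> real q * tau" using tau_pos by simp
  ultimately have ab': "tau < a'" "a' < b'" "b' < alpha" and qa: "real q * tau < a"
    using assms tau_pos unfolding a'_def b'_def by linarith+
  have eq: "(F lam ^^ i) (meet lam a b) = (F lam ^^ j) (meet lam a' b')"
    using F_iter_4_mult_meet[OF qa assms(2,3)] by (simp add: i a'_def b'_def funpow_add)
  have pos: "0 < a'" using ab' tau_pos by simp
  show "(F lam ^^ i) (meet lam a b) \<notin> G ` Lam lam"
  proof (cases "j = 0")
    case True
    then show ?thesis using eq meet_in_G_Lam_iff[OF pos ab'(2,3)] ab' by simp
  next
    case False
    then have bnds: "alpha \<le> real j * alpha" "real j * alpha \<le> 3 * alpha"
      using j alpha_pos mult_right_mono[of 1 "real j" alpha] mult_right_mono[of "real j" 3 alpha]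
      by auto
    have "meet lam (a' + real j * alpha) (b' + real j * alpha) \<in> Sector lam \<longleftrightarrow>
        0 < a' + real j * alpha \<and> b' + real j * alpha < alpha"
      using bnds ab' pos angle_bounds by (intro meet_in_Sector_iff; linarith)
    then have "meet lam (a' + real j * alpha) (b' + real j * alpha) \<notin> Sector lam"
      using bnds ab' pos by linarith
    then show ?thesis
      using eq F_iter_meet[OF pos ab'(2,3) j] G_Lam_subset_Sector by auto
  qed
  show "iota lam ((F lam ^^ i) (meet lam a b)) = 1"
    using eq iota_iter_meet[OF pos ab'(2,3) j] iota_F3_meet[OF pos ab'(2,3)] j ab'
    by (cases "j = 3") auto
qed

text \<open>\<open>F^(4k)\<close> moves \<open>a\<close> by \<open>-k\<tau>\<close>, and \<open>k\<close> is the first number for which this gives a value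
  \<open>\<le> \<tau>\<close>.\<close>

lemma
  assumes "real k * tau < a" "a \<le> real (Suc k) * tau" "a < b" "alpha - tau \<le> b" "b < alpha"
  shows meet_in_Lin_dom: "meet lam a b \<in> Lin_dom lam"
    and transit_meet: "transit lam (meet lam a b) = 4 * k"
    and ret_word_meet: "ret_word lam (meet lam a b) = replicate (4 * k) 1"
    and Lin_meet: "Lin lam (meet lam a b) = meet lam (alpha - b + real k * tau) (alpha - a + real k * tau)"
proof -
  have pos: "0 < a" using assms(1) mult_tau_nonneg[of k] by linarith
  have end_pt: "(F lam ^^ (4 * k)) (meet lam a b) = meet lam (a - real k * tau) (b - real k * tau)"
    using assms by (intro F_iter_4_mult_meet) auto
  have "b - real k * tau < alpha"
    using assms mult_tau_nonneg[of k] by linarith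
  then have exit: "(F lam ^^ (4 * k)) (meet lam a b) \<in> G ` Lam lam"
    unfolding end_pt using assms by (subst meet_in_G_Lam_iff) (auto simp: algebra_simps)
  then show "meet lam a b \<in> Lin_dom lam"
    using meet_in_Lam_iff[of a b] pos assms by (auto simp: Lin_dom_def)
  show tr: "transit lam (meet lam a b) = 4 * k"
    unfolding transit_def
  proof (rule Least_equality)
    fix t assume "(F lam ^^ t) (meet lam a b) \<in> G ` Lam lam"
    then show "4 * k \<le> t"
      using F_iter_iota_meet(1)[of k a b t] assms by force
  qed (fact exit)
  show "ret_word lam (meet lam a b) = replicate (4 * k) 1"
    unfolding ret_word_def tr using F_iter_iota_meet(2)[of k a b] assms
    by (intro nth_equalityI) auto
  show "Lin lam (meet lam a b) = meet lam (alpha - b + real k * tau) (alpha - a + real k * tau)"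
    unfolding Lin_def tr end_pt G_meet by (simp add: algebra_simps)
qed

section \<open>The atoms\<close>

text \<open>The entrance points that take \<open>k\<close> rounds to the exit. The condition \<open>a < b\<close> cuts the
  rectangle only for the largest \<open>k\<close>, when \<open>(k+1)\<tau> \<ge> \<alpha> - \<tau>\<close>.\<close>

definition cell :: "nat \<Rightarrow> plane set" where
  "cell k = {meet lam a b |a b. real k * tau < a \<and> a \<le> real (Suc k) * tau \<and> a < b
     \<and> alpha - tau \<le> b \<and> b < alpha}"

lemma cellI:
  assumes "real k * tau < a" "a \<le> real (Suc k) * tau" "a < b" "alpha - tau \<le> b" "b < alpha"
  shows "meet lam a b \<in> cell k"
  unfolding cell_def using assms by (intro CollectI exI conjI) (rule refl)

lemma cellE:
  assumes "z \<in> cell k"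
  obtains a b where "z = meet lam a b" "real k * tau < a" "a \<le> real (Suc k) * tau" "a < b"
    "alpha - tau \<le> b" "b < alpha"
  using assms unfolding cell_def by (elim CollectE exE conjE)

lemma cell_const_return: "const_return lam (cell k)"
  unfolding const_return_def cell_def
  using meet_in_Lin_dom transit_meet ret_word_meet by (auto 0 3)

lemma transit_cell: "z \<in> cell k \<Longrightarrow> transit lam z = 4 * k"
  unfolding cell_def using transit_meet by auto

lemma Lam_subset_cells: "z \<in> Lam lam \<Longrightarrow> \<exists>k. z \<in> cell k"
proof -
  assume "z \<in> Lam lam"
  then obtain a b where z: "z = meet lam a b" and ab: "0 < a" "a < b" "alpha - tau \<le> b" "b < alpha"
    by (auto simp: Lam_eq)
  define k where "k = nat (\<lceil>a / tau\<rceil> - 1)"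
  have "0 < \<lceil>a / tau\<rceil>"
    using ab tau_pos by simp
  then have "real k = of_int \<lceil>a / tau\<rceil> - 1"
    by (simp add: k_def)
  moreover have "of_int \<lceil>a / tau\<rceil> - 1 < a / tau" "a / tau \<le> of_int \<lceil>a / tau\<rceil>"
    using ceiling_correct[of "a / tau"] by auto
  ultimately have "real k < a / tau" "a / tau \<le> real (Suc k)"
    by simp_all
  then have "real k * tau < a" "a \<le> real (Suc k) * tau"
    using tau_pos by (simp_all only: pos_less_divide_eq pos_divide_le_eq)
  then show ?thesis
    using z ab cellI by blast
qed

lemma continuous_on_meet:
  assumes "\<And>p. p \<in> S \<Longrightarrow> fst p \<le> snd p \<and> snd p < fst p + pi"
  shows "continuous_on S (\<lambda>p. meet lam (fst p) (snd p))"
proof -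
  have "cos ((snd p - fst p) / 2) \<noteq> 0" if "p \<in> S" for p
  proof -
    have "0 < cos ((snd p - fst p) / 2)"
      using assms[OF that] by (intro cos_gt_zero_pi; simp add: field_simps)
    then show ?thesis by simp
  qed
  then show ?thesis
    unfolding meet_def by (intro continuous_intros) auto
qed

text \<open>In the coordinates \<open>(a, b)\<close> the cell is a rectangle intersected with a half-plane, hence convex.\<close>

lemma connected_cell: "connected (cell k)"
proof -
  define D where "D = ({real k * tau<..real (Suc k) * tau} \<times> {alpha - tau..<alpha})
    \<inter> {p. 0 < (-1, 1) \<bullet> p}"
  have D_iff: "p \<in> D \<longleftrightarrow> real k * tau < fst p \<and> fst p \<le> real (Suc k) * tau \<and> fst p < snd p
     \<and> alpha - tau \<le> snd p \<and> snd p < alpha" for p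
    by (auto simp: D_def mem_Times_iff inner_prod_def)
  have "convex D"
    unfolding D_def
    by (intro convex_Int convex_Times convex_real_interval convex_halfspace_gt)
  moreover have "cell k = (\<lambda>p. meet lam (fst p) (snd p)) ` D"
  proof (intro equalityI subsetI)
    fix z assume "z \<in> cell k"
    then obtain a b where "z = meet lam a b" "(a, b) \<in> D"
      by (elim cellE) (auto simp: D_iff)
    then show "z \<in> (\<lambda>p. meet lam (fst p) (snd p)) ` D"
      by (intro image_eqI[of _ _ "(a, b)"]) auto
  next
    fix z assume "z \<in> (\<lambda>p. meet lam (fst p) (snd p)) ` D"
    then obtain p where "z = meet lam (fst p) (snd p)" "p \<in> D" by auto
    then show "z \<in> cell k"
      unfolding D_iff by (auto intro: cellI)
  qed
  moreover have "continuous_on D (\<lambda>p. meet lam (fst p) (snd p))"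
  proof (rule continuous_on_meet)
    fix p assume "p \<in> D"
    then show "fst p \<le> snd p \<and> snd p < fst p + pi"
      unfolding D_iff using mult_tau_nonneg[of k] angle_bounds by linarith
  qed
  ultimately show ?thesis
    by (simp add: connected_continuous_image convex_connected)
qed

lemma const_return_subset_Lam: "const_return lam B \<Longrightarrow> B \<subseteq> Lam lam"
  unfolding const_return_def Lin_dom_def by (erule conjE) (erule subset_trans, rule Collect_restrict)

text \<open>Already the transit time determines the cell.\<close>

lemma const_return_subset_cell:
  assumes "const_return lam B" "z \<in> B" "z \<in> cell k"
  shows "B \<subseteq> cell k"
proof
  fix w assume w: "w \<in> B"
  then have "w \<in> Lam lam"
    using const_return_subset_Lam[OF assms(1)] by (rule rev_subsetD)
  then obtain j where j: "w \<in> cell j"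
    by (rule exE[OF Lam_subset_cells])
  have "transit lam z = transit lam w"
    using assms(1)[unfolded const_return_def, THEN conjunct2, THEN bspec, OF assms(2), THEN bspec, OF w]
    by (rule conjunct1)
  then have "j = k"
    using transit_cell[OF j] transit_cell[OF assms(3)] by simp
  then show "w \<in> cell k" using j by simp
qed

text \<open>Maximality of the cells is \<open>const_return_subset_cell\<close>; conversely an atom is contained in a cell and so equals it.\<close>

lemma atoms_eq: "atoms lam = {cell k |k. cell k \<noteq> {}}"
proof (intro equalityI subsetI)
  fix A assume "A \<in> atoms lam"
  then have A: "A \<noteq> {} \<and> connected A \<and> const_return lam A \<and>
      (\<forall>B. A \<subseteq> B \<and> connected B \<and> const_return lam B \<longrightarrow> B = A)"
    unfolding atoms_def by (rule CollectD)
  note ret = A[THEN conjunct2, THEN conjunct2, THEN conjunct1]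
    and max = A[THEN conjunct2, THEN conjunct2, THEN conjunct2]
  have "A \<noteq> {}" using A by (rule conjunct1)
  then obtain z where z: "z \<in> A" by fast
  have "z \<in> Lam lam"
    using z const_return_subset_Lam[OF ret] by (rule rev_subsetD)
  then obtain k where k: "z \<in> cell k"
    by (rule exE[OF Lam_subset_cells])
  have "A \<subseteq> cell k"
    using ret z k by (rule const_return_subset_cell)
  then have "cell k = A"
    by (intro max[THEN spec, THEN mp] conjI connected_cell cell_const_return)
  then have "A = cell k" "cell k \<noteq> {}"
    using k by auto
  then show "A \<in> {cell k |k. cell k \<noteq> {}}"
    by (intro CollectI exI conjI)
next
  fix A assume "A \<in> {cell k |k. cell k \<noteq> {}}"
  then obtain k where A: "A = cell k" and "cell k \<noteq> {}"
    by (elim CollectE exE conjE)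
  then obtain z where z: "z \<in> cell k" by fast
  have max: "B = A" if "A \<subseteq> B \<and> connected B \<and> const_return lam B" for B
  proof (rule antisym)
    have "z \<in> B" using that z A by fast
    then show "B \<subseteq> A"
      using const_return_subset_cell[of B z k] that z A by simp
  qed (use that in simp)
  show "A \<in> atoms lam"
    unfolding atoms_def
  proof (intro CollectI conjI allI impI)
    show "A \<noteq> {}" using z A by fast
    show "connected A" "const_return lam A"
      unfolding A by (rule connected_cell, rule cell_const_return)
  qed (rule max)
qed

text \<open>Since \<open>1 - 4\<rho> = \<tau>/(2\<pi>)\<close> and \<open>2\<pi> - \<tau> = 4\<alpha>\<close>.\<close>

lemma NN_eq: "NN lam = nat \<lfloor>alpha / tau\<rfloor>"
proof -
  have "4 * (1 - 4 * rho lam) = 2 * tau / pi"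
    by (simp add: rho_def drift_def angle_def field_simps)
  then have "1 / (4 * (1 - 4 * rho lam)) - 1 / 4 = pi / (2 * tau) - 1 / 4"
    by simp
  also have "\<dots> = alpha / tau"
  proof -
    have "2 * pi - tau = 4 * alpha"
      by (simp add: four_alpha)
    then show ?thesis
      using tau_pos by (simp add: field_simps)
  qed
  finally show ?thesis
    by (simp add: NN_def)
qed

lemma NN_le: "real (NN lam) * tau \<le> alpha" and less_NN: "alpha < real (Suc (NN lam)) * tau"
proof -
  have "0 \<le> alpha / tau"
    using angle_bounds by simp
  then have "real (NN lam) \<le> alpha / tau" "alpha / tau < real (Suc (NN lam))"
    unfolding NN_eq by (simp_all add: floor_correct) linarith
  then show "real (NN lam) * tau \<le> alpha" "alpha < real (Suc (NN lam)) * tau"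
    using tau_pos by (simp_all only: pos_le_divide_eq pos_divide_less_eq)
qed

lemma cell_empty:
  assumes "NN lam < k"
  shows "cell k = {}"
proof -
  have "real (Suc (NN lam)) * tau \<le> real k * tau"
    using assms tau_pos by (intro mult_right_mono) auto
  then show ?thesis
    using less_NN by (auto simp: cell_def)
qed

subsection \<open>Tangent lines and the quadrilaterals\<close>

lemma supp_G: "supp lam psi (G z) = supp lam (alpha - psi) z"
  by (simp add: supp_def G_def add.commute)

lemma supp_C: "supp lam psi (centre lam + C lam v) = supp lam (psi - alpha) (centre lam + v)"
proof -
  define s where "s = alpha - psi"
  have psi: "alpha - (psi - alpha) = s + alpha" "psi - alpha = - s" "psi = alpha - s"
    by (simp_all add: s_def)
  have h: "sin (s + alpha) = sin s * lam + sin (alpha - s)"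
    using cos_alpha by (simp add: sin_add sin_diff)
  have "sin s * (lam * x - y) + sin (alpha - s) * x = sin (s + alpha) * x + sin (- s) * y" for x y
    unfolding h by (simp add: algebra_simps)
  then have "sin (alpha - psi) * (lam * x - y) + sin psi * x
      = sin (alpha - (psi - alpha)) * x + sin (psi - alpha) * y" for x y
    unfolding psi(1,2) by (simp add: s_def)
  then show ?thesis
    by (simp add: supp_def C_def centre_eq)
qed

lemma supp_periodic: "supp lam (psi - 2 * pi) z = supp lam psi z"
  by (simp add: supp_linear[of "psi - 2 * pi"] supp_linear[of psi] sin_diff cos_diff)

text \<open>Four steps change the angle by \<open>4\<alpha>\<close>, which is \<open>-\<tau>\<close> modulo \<open>2\<pi>\<close>.\<close>

lemma supp_rot4: "supp lam psi (rot4 lam n z) = supp lam (psi + real n * tau) z"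
proof (induction n arbitrary: psi)
  case 0
  then show ?case by (simp add: rot4_def)
next
  case (Suc n)
  define v where "v = (C lam ^^ (4 * n)) (z - centre lam)"
  have "(C lam ^^ 4) w = C lam (C lam (C lam (C lam w)))" for w
    by (simp add: numeral_eq_Suc)
  then have "(C lam ^^ (4 * Suc n)) (z - centre lam) = C lam (C lam (C lam (C lam v)))"
    by (simp only: mult_Suc_right funpow_add comp_apply v_def)
  then have "supp lam psi (rot4 lam (Suc n) z) = supp lam (psi - alpha - alpha - alpha - alpha) (centre lam + v)"
    by (simp add: rot4_def supp_C)
  also have "psi - alpha - alpha - alpha - alpha = psi + tau - 2 * pi"
    using four_alpha by linarith
  also have "supp lam (psi + tau - 2 * pi) (centre lam + v) = supp lam (psi + tau) (rot4 lam n z)"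
    unfolding supp_periodic by (simp add: rot4_def v_def)
  finally show ?case
    using Suc.IH by (simp add: algebra_simps)
qed

lemma surj_rot4: "surj (rot4 lam n)"
proof -
  have "C lam (snd w, lam * snd w - fst w) = w" for w
    by (simp add: C_def prod_eq_iff)
  then have "surj (C lam)"
    by (rule surjI[of "C lam" "\<lambda>w. (snd w, lam * snd w - fst w)"])
  then have surj: "surj (C lam ^^ (4 * n))" by (rule surj_fn)
  show ?thesis
  proof (rule surjI)
    fix w
    show "rot4 lam n (centre lam + inv (C lam ^^ (4 * n)) (w - centre lam)) = w"
      using surj_f_inv_f[OF surj] by (simp add: rot4_def)
  qed
qed

lemma ell_eq: "ell lam n = {z. supp lam (alpha - real n * tau) z = 1}"
proof -
  have one: "snd z = 1 \<longleftrightarrow> supp lam alpha z = 1" for z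
    using kappa_pos by (simp add: supp_alpha field_simps)
  show ?thesis
  proof (intro equalityI subsetI)
    fix z assume "z \<in> ell lam n"
    then show "z \<in> {z. supp lam (alpha - real n * tau) z = 1}"
      by (auto simp: ell_def one supp_rot4)
  next
    fix z assume z: "z \<in> {z. supp lam (alpha - real n * tau) z = 1}"
    obtain w where w: "z = rot4 lam n w"
      using surj_rot4 by (metis surjD)
    then show "z \<in> ell lam n"
      using z by (auto simp: ell_def one supp_rot4)
  qed
qed

lemma G_ell_eq: "G ` ell lam n = {z. supp lam (real n * tau) z = 1}"
proof (intro equalityI subsetI)
  fix z assume "z \<in> G ` ell lam n"
  then show "z \<in> {z. supp lam (real n * tau) z = 1}"
    by (auto simp: ell_eq supp_G)
next
  fix z assume "z \<in> {z. supp lam (real n * tau) z = 1}"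
  then have "G z \<in> ell lam n"
    by (simp add: ell_eq supp_G)
  then show "z \<in> G ` ell lam n"
    by (metis G_G imageI)
qed

lemma supp_eq_at_two_imp_eq:
  assumes "supp lam p z = supp lam p w" "supp lam q z = supp lam q w" "sin (q - p) \<noteq> 0"
  shows "z = w"
proof -
  define du where "du = supp lam 0 z - supp lam 0 w"
  define dv where "dv = (supp lam alpha z - supp lam 0 z * cos alpha) / sin alpha
    - (supp lam alpha w - supp lam 0 w * cos alpha) / sin alpha"
  have lin: "du * cos psi + dv * sin psi = supp lam psi z - supp lam psi w" for psi
    unfolding supp_linear[of psi z] supp_linear[of psi w] du_def dv_def by (simp add: algebra_simps)
  have p: "du * cos p + dv * sin p = 0" and q: "du * cos q + dv * sin q = 0"
    unfolding lin using assms by simp_all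
  have "du * sin (q - p) = 0" "dv * sin (q - p) = 0"
    unfolding sin_diff using p q by algebra+
  then have "du = 0" "dv = 0" using assms(3) by simp_all
  then have "supp lam psi z = supp lam psi w" for psi
    using lin[of psi] by simp
  then show ?thesis by (intro supp_eqI)
qed

lemma T0_eq: "T0 lam = meet lam alpha alpha"
proof -
  have "kappa * (2 - lam) = 1 - lam"
    using lam_less_1 by (simp add: scale_def)
  then have "kappa * lam = 2 * kappa - 1 + lam"
    by (simp add: algebra_simps)
  then have "(1 + lam) / 2 = 1 - kappa + kappa * cos alpha"
    by (simp add: cos_alpha field_simps)
  then show ?thesis
    by (simp add: T0_def meet_def)
qed

text \<open>For \<open>n\<tau> < \<alpha> - i\<tau>\<close> the lines are distinct tangents whose angles differ by less than \<open>\<pi>\<close>, so they meet in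
  one point. In the case of equality both lines are the tangent at this angle, and its point of tangency is
  what the coordinates describe.\<close>

lemma Qpt_eq:
  assumes "real n * tau \<le> alpha - real i * tau"
  shows "Qpt lam i n = meet lam (real n * tau) (alpha - real i * tau)"
proof (cases "real n * tau = alpha - real i * tau")
  case True
  have "supp lam psi (rot4 lam i (T0 lam)) = supp lam psi (meet lam (real n * tau) (alpha - real i * tau))" for psi
  proof -
    have eq: "psi + real i * tau - (alpha + alpha) / 2
        = psi - (alpha - real i * tau + (alpha - real i * tau)) / 2"
      by (simp add: field_simps)
    then show ?thesis
      unfolding T0_eq supp_rot4 supp_meet True eq by (simp only: diff_self)
  qed
  then have "rot4 lam i (T0 lam) = meet lam (real n * tau) (alpha - real i * tau)"
    by (intro supp_eqI)
  moreover have "ell lam i = G ` ell lam n"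
    unfolding G_ell_eq unfolding ell_eq True ..
  ultimately show ?thesis
    by (simp add: Qpt_def)
next
  case False
  define p q where "p = real n * tau" and "q = alpha - real i * tau"
  have pq: "0 \<le> p" "p < q" "q \<le> alpha"
    using assms False mult_tau_nonneg[of n] mult_tau_nonneg[of i] by (auto simp: p_def q_def)
  \<comment> \<open>The point where ell i touches the ellipse tells the two lines apart.\<close>
  have "supp lam p (meet lam q q) < 1" "supp lam q (meet lam q q) = 1"
    using pq angle_bounds by (auto intro!: supp_meet_less_1 supp_meet_eq_1)
  then have "meet lam q q \<in> ell lam i" "meet lam q q \<notin> G ` ell lam n"
    unfolding G_ell_eq unfolding ell_eq by (simp_all add: p_def q_def)
  then have ne: "ell lam i \<noteq> G ` ell lam n" by auto
  have at: "supp lam p (meet lam p q) = 1" "supp lam q (meet lam p q) = 1"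
    using pq angle_bounds by (auto intro!: supp_meet_eq_1)
  have "sin (q - p) \<noteq> 0"
    using sin_gt_zero[of "q - p"] pq angle_bounds by auto
  have mem: "z \<in> ell lam i \<inter> G ` ell lam n \<longleftrightarrow> supp lam q z = 1 \<and> supp lam p z = 1" for z
    unfolding G_ell_eq unfolding ell_eq p_def q_def by simp
  have "(THE z. z \<in> ell lam i \<inter> G ` ell lam n) = meet lam p q"
    unfolding mem
  proof (rule the_equality)
    fix z assume "supp lam q z = 1 \<and> supp lam p z = 1"
    then show "z = meet lam p q"
      using at \<open>sin (q - p) \<noteq> 0\<close> by (intro supp_eq_at_two_imp_eq[of p z _ q]) simp_all
  qed (use at in simp)
  then show ?thesis
    using ne by (simp add: Qpt_def p_def q_def)
qed

text \<open>Along the tangent at angle \<open>a\<close> the position is an affine function of \<open>tan ((b - a)/2)\<close>. This makes points with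
  the same \<open>a\<close> collinear and ordered by \<open>b\<close>.\<close>

lemma meet_on_tangent:
  assumes "cos ((b - a) / 2) \<noteq> 0"
  shows "meet lam a b = (1 - kappa + kappa * (cos a - sin a * tan ((b - a) / 2)),
    1 - kappa + kappa * (cos (alpha - a) + sin (alpha - a) * tan ((b - a) / 2)))"
proof -
  define d where "d = (b - a) / 2"
  have d: "(a + b) / 2 = a + d" "alpha - (a + d) = alpha - a - d"
    by (simp_all add: d_def field_simps)
  have "cos (a + d) / cos d = cos a - sin a * tan d"
    "cos (alpha - a - d) / cos d = cos (alpha - a) + sin (alpha - a) * tan d"
    using assms unfolding d_def[symmetric] cos_add cos_diff[of "alpha - a"]
    by (simp_all add: tan_def field_simps)
  then show ?thesis
    unfolding meet_def d d_def[symmetric] by simp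
qed

lemma meet_in_segment:
  assumes "b1 \<le> b" "b \<le> b2" "a - pi < b1" "b2 < a + pi"
  shows "meet lam a b \<in> closed_segment (meet lam a b1) (meet lam a b2)"
proof (cases "b1 < b2")
  case False
  then have "b = b1" "b2 = b1" using assms by auto
  then show ?thesis by simp
next
  case True
  have cos_ne: "cos ((x - a) / 2) \<noteq> 0" if "b1 \<le> x" "x \<le> b2" for x
  proof -
    have "0 < cos ((x - a) / 2)"
      using that assms by (intro cos_gt_zero_pi; simp add: field_simps)
    then show ?thesis by simp
  qed
  define t where "t x = tan ((x - a) / 2)" for x
  have tan_mono: "t x < t y" if "b1 \<le> x" "x < y" "y \<le> b2" for x y
    unfolding t_def using that assms by (intro tan_monotone; simp add: field_simps)
  have t: "t b1 \<le> t b" "t b \<le> t b2" "t b1 < t b2"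
    using tan_mono[of b1 b] tan_mono[of b b2] tan_mono[of b1 b2] True assms
    by (cases "b = b1"; cases "b = b2"; auto)+
  define u where "u = (t b - t b1) / (t b2 - t b1)"
  have u: "0 \<le> u" "u \<le> 1"
    using t by (auto simp: u_def)
  have "u * (t b2 - t b1) = t b - t b1"
    using t by (simp add: u_def)
  then have tb: "t b = (1 - u) * t b1 + u * t b2"
    by (simp add: algebra_simps)
  have pt: "meet lam a x = (1 - kappa + kappa * (cos a - sin a * t x),
      1 - kappa + kappa * (cos (alpha - a) + sin (alpha - a) * t x))" if "b1 \<le> x" "x \<le> b2" for x
    unfolding t_def using cos_ne[OF that] by (rule meet_on_tangent)
  have "meet lam a b = (1 - u) *\<^sub>R meet lam a b1 + u *\<^sub>R meet lam a b2"
    using assms True by (simp add: pt tb) (simp add: algebra_simps)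
  then show ?thesis
    using u by (auto simp: in_segment)
qed

lemma supp_affine:
  assumes "u + v = 1"
  shows "supp lam psi (u *\<^sub>R z + v *\<^sub>R w) = u * supp lam psi z + v * supp lam psi w"
proof -
  have u: "u = 1 - v" using assms by simp
  show ?thesis
    unfolding u supp_def by (simp add: divide_simps) (simp add: algebra_simps)
qed

lemma supp_hull_bounds:
  assumes "z \<in> convex hull S"
  shows "(\<And>w. w \<in> S \<Longrightarrow> r \<le> supp lam psi w) \<Longrightarrow> r \<le> supp lam psi z"
    and "(\<And>w. w \<in> S \<Longrightarrow> supp lam psi w \<le> r) \<Longrightarrow> supp lam psi z \<le> r"
proof -
  show "r \<le> supp lam psi z" if ge: "\<And>w. w \<in> S \<Longrightarrow> r \<le> supp lam psi w"
  proof -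
    have "convex {w. r \<le> supp lam psi w}"
    proof (rule convexI)
      fix x y u v assume *: "x \<in> {w. r \<le> supp lam psi w}" "y \<in> {w. r \<le> supp lam psi w}"
        "0 \<le> (u :: real)" "0 \<le> (v :: real)" "u + v = 1"
      then show "u *\<^sub>R x + v *\<^sub>R y \<in> {w. r \<le> supp lam psi w}"
        using convex_bound_le[of "- supp lam psi x" "- r" "- supp lam psi y" u v]
        by (simp add: supp_affine)
    qed
    then have "convex hull S \<subseteq> {w. r \<le> supp lam psi w}"
      using ge by (intro hull_minimal) auto
    then show ?thesis using assms by blast
  qed
  show "supp lam psi z \<le> r" if le: "\<And>w. w \<in> S \<Longrightarrow> supp lam psi w \<le> r"
  proof -
    have "convex {w. supp lam psi w \<le> r}"
      by (intro convexI) (auto simp: supp_affine intro: convex_bound_le)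
    then have "convex hull S \<subseteq> {w. supp lam psi w \<le> r}"
      using le by (intro hull_minimal) auto
    then show ?thesis using assms by blast
  qed
qed

text \<open>Being beyond the tangents at \<open>q \<le> q'\<close> forces \<open>[a, b]\<close> to contain \<open>q\<close> and \<open>q'\<close>; not being beyond those at
  \<open>p < q\<close> and \<open>p' > q'\<close> then stops it on either side.\<close>

lemma half_planes_imp_meet:
  assumes "1 \<le> supp lam q z" "1 \<le> supp lam q' z" "supp lam p z \<le> 1" "supp lam p' z \<le> 1"
    and "0 \<le> p" "p < q" "q \<le> q'" "q' < p'" "p' \<le> alpha"
  obtains a b where "z = meet lam a b" "p \<le> a" "a \<le> q" "q' \<le> b" "b \<le> p'"
proof -
  obtain m r where m: "\<bar>m - q\<bar> \<le> pi" and r: "0 \<le> r"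
    and supp: "\<And>psi. supp lam psi z = r * cos (psi - m)"
    using supp_polar[of q z] by metis
  have "r * cos (q - m) \<le> r * 1"
    using r by (intro mult_left_mono) auto
  then have "1 \<le> r"
    using assms(1) unfolding supp by simp
  then obtain d where d: "0 \<le> d" "d < pi / 2" "r = 1 / cos d" "z = meet lam (m - d) (m + d)"
    using polar_imp_meet[of r z m] supp by metis
  have cd: "0 < cos d" using d by (intro cos_gt_zero_pi) auto
  have ge: "\<bar>psi - m\<bar> \<le> d" if "1 \<le> supp lam psi z" "\<bar>psi - m\<bar> < 2 * pi - d" for psi
  proof (rule ccontr)
    assume "\<not> \<bar>psi - m\<bar> \<le> d"
    then have "cos (psi - m) < cos d"
      using that d by (intro cos_less_cos) auto
    then show False
      using that(1) cd unfolding supp d(3) by (simp add: field_simps)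
  qed
  have le: "d \<le> \<bar>psi - m\<bar>" if "supp lam psi z \<le> 1" for psi
  proof (rule ccontr)
    assume *: "\<not> d \<le> \<bar>psi - m\<bar>"
    then have "cos d < cos \<bar>psi - m\<bar>"
      using d by (intro cos_monotone_0_pi) auto
    then show False
      using that(1) cd unfolding supp d(3) by (simp add: field_simps)
  qed
  have q: "\<bar>q - m\<bar> \<le> d"
    using ge[OF assms(1)] m d by linarith
  have q': "\<bar>q' - m\<bar> \<le> d"
    using ge[OF assms(2)] q d assms angle_bounds by linarith
  have "d \<le> \<bar>p - m\<bar>" "d \<le> \<bar>p' - m\<bar>"
    using le[OF assms(3)] le[OF assms(4)] .
  then have "p \<le> m - d" "m + d \<le> p'"
    using q q' assms by linarith+
  moreover have "m - d \<le> q" "q' \<le> m + d"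
    using q q' by linarith+
  ultimately show thesis
    using that d(4) by blast
qed

text \<open>Move first in \<open>a\<close> along the two tangents bounding the range of \<open>b\<close>, then in \<open>b\<close>.\<close>

lemma meet_in_hull:
  assumes "p \<le> a" "a \<le> q" "q' \<le> b" "b \<le> p'" "q \<le> q'" "p' < p + pi"
  shows "meet lam a b \<in> convex hull {meet lam q p', meet lam p p', meet lam p q', meet lam q q'}"
    (is "_ \<in> convex hull ?V")
proof -
  have seg: "closed_segment x y \<subseteq> convex hull ?V" if "x \<in> convex hull ?V" "y \<in> convex hull ?V" for x y
    using that by (intro closed_segment_subset convex_convex_hull)
  have V: "v \<in> convex hull ?V" if "v \<in> ?V" for v
    using that by (rule hull_inc)
  have row: "meet lam a x \<in> closed_segment (meet lam p x) (meet lam q x)"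
    if "q' \<le> x" "x \<le> p'" for x
    using meet_in_segment[of p a q x] that assms by (simp add: meet_commute)
  have "meet lam a q' \<in> convex hull ?V"
    using row[of q'] seg[OF V V, of "meet lam p q'" "meet lam q q'"] assms by auto
  moreover have "meet lam a p' \<in> convex hull ?V"
    using row[of p'] seg[OF V V, of "meet lam p p'" "meet lam q p'"] assms by auto
  moreover have "meet lam a b \<in> closed_segment (meet lam a q') (meet lam a p')"
    using assms by (intro meet_in_segment) auto
  ultimately show ?thesis
    using seg by blast
qed

lemma
  assumes "real (Suc (Suc k)) * tau \<le> alpha"
  shows vertices_eq: "vertices lam (Suc k) =
      {meet lam (real (Suc k) * tau) alpha, meet lam (real k * tau) alpha,
       meet lam (real k * tau) (alpha - tau), meet lam (real (Suc k) * tau) (alpha - tau)}"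
    and Qpt_0_Suc: "Qpt lam 0 (Suc k) = meet lam (real (Suc k) * tau) alpha"
    and Qpt_0: "Qpt lam 0 k = meet lam (real k * tau) alpha"
    and Qpt_1: "Qpt lam 1 k = meet lam (real k * tau) (alpha - tau)"
    and Qpt_1_Suc: "Qpt lam 1 (Suc k) = meet lam (real (Suc k) * tau) (alpha - tau)"
proof -
  have "real k * tau + tau + tau \<le> alpha"
    using assms by (simp add: algebra_simps)
  moreover have "real (Suc k) * tau = real k * tau + tau"
    by (simp add: algebra_simps)
  ultimately show "Qpt lam 0 (Suc k) = meet lam (real (Suc k) * tau) alpha"
    "Qpt lam 0 k = meet lam (real k * tau) alpha"
    "Qpt lam 1 k = meet lam (real k * tau) (alpha - tau)"
    "Qpt lam 1 (Suc k) = meet lam (real (Suc k) * tau) (alpha - tau)"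
    using tau_pos Qpt_eq[of "Suc k" 0] Qpt_eq[of k 0] Qpt_eq[of k 1] Qpt_eq[of "Suc k" 1] by simp_all
  then show "vertices lam (Suc k) =
      {meet lam (real (Suc k) * tau) alpha, meet lam (real k * tau) alpha,
       meet lam (real k * tau) (alpha - tau), meet lam (real (Suc k) * tau) (alpha - tau)}"
    unfolding vertices_def by simp
qed

text \<open>The vertex may lie on the ellipse (\<open>q = q'\<close>); then no point with \<open>a < b\<close> equals it.\<close>

lemma meet_eq_inner_vertex:
  assumes "meet lam a b = meet lam q q'" "a \<le> q" "a < b" "q' \<le> b" "q \<le> q'" "0 \<le> a" "b \<le> alpha"
  shows "a = q" "b = q'"
proof -
  have "q \<le> a" "b \<le> q'"
    using meet_eq_imp_left_le[OF assms(1)] meet_eq_imp_right_le[OF assms(1)] assms angle_bounds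
    by auto
  then show "a = q" "b = q'" using assms by auto
qed

text \<open>Three of the four vertices lie on the removed sides, so at most the vertex on the two kept sides is in the cell.\<close>

lemma cell_minus_vertices:
  assumes "real (Suc (Suc k)) * tau \<le> alpha"
  shows "cell k - vertices lam (Suc k) = {meet lam a b |a b. real k * tau < a \<and> a \<le> real (Suc k) * tau
     \<and> a < b \<and> alpha - tau \<le> b \<and> b < alpha \<and> (a, b) \<noteq> (real (Suc k) * tau, alpha - tau)}"
    (is "?L = ?R")
proof -
  define p q q' where "p = real k * tau" and "q = real (Suc k) * tau" and "q' = alpha - tau"
  have pq: "0 \<le> p" "p < q" "q \<le> q'" "q' < alpha"
    using assms mult_tau_nonneg[of k] tau_pos by (auto simp: p_def q_def q'_def algebra_simps)
  have iff: "meet lam a b \<in> vertices lam (Suc k) \<longleftrightarrow> (a, b) = (q, q')"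
    if ab: "p < a" "a \<le> q" "a < b" "q' \<le> b" "b < alpha" for a b
  proof
    assume "meet lam a b \<in> vertices lam (Suc k)"
    then have *: "meet lam a b \<in> {meet lam q alpha, meet lam p alpha, meet lam p q', meet lam q q'}"
      unfolding vertices_eq[OF assms] p_def q_def q'_def .
    have "supp lam p (meet lam a b) < 1" "supp lam alpha (meet lam a b) < 1"
      using ab pq angle_bounds by (intro supp_meet_less_1; linarith)+
    moreover have "supp lam alpha (meet lam q alpha) = 1" "supp lam p (meet lam p alpha) = 1"
      "supp lam p (meet lam p q') = 1"
      using pq angle_bounds by (intro supp_meet_eq_1; linarith)+
    ultimately have "meet lam a b = meet lam q q'"
      using * by auto
    then have "a = q" "b = q'"
      using meet_eq_inner_vertex[of a b q q'] ab pq by simp_all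
    then show "(a, b) = (q, q')" by simp
  next
    assume "(a, b) = (q, q')"
    then show "meet lam a b \<in> vertices lam (Suc k)"
      unfolding vertices_eq[OF assms] p_def q_def q'_def by simp
  qed
  show ?thesis
  proof (intro equalityI subsetI)
    fix z assume z: "z \<in> ?L"
    then obtain a b where ab: "z = meet lam a b" "p < a" "a \<le> q" "a < b" "q' \<le> b" "b < alpha"
      unfolding p_def q_def q'_def by (elim DiffE cellE)
    then have "(a, b) \<noteq> (q, q')"
      using iff[OF ab(2-)] z by simp
    then show "z \<in> ?R"
      using ab unfolding p_def q_def q'_def by (intro CollectI exI conjI)
  next
    fix z assume "z \<in> ?R"
    then obtain a b where ab: "z = meet lam a b" "p < a" "a \<le> q" "a < b" "q' \<le> b" "b < alpha"
      and "(a, b) \<noteq> (q, q')"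
      unfolding p_def q_def q'_def by (elim CollectE exE conjE)
    then show "z \<in> ?L"
      using iff[OF ab(2-)] cellI[of k a b] unfolding p_def q_def q'_def by simp
  qed
qed

text \<open>The hull is described by the half-planes of its four sides, and half-planes of tangents are inequalities for
  \<open>a\<close> and \<open>b\<close>. Removing the two sides turns \<open>a \<ge> k\<tau>\<close> and \<open>b \<le> \<alpha>\<close> into strict inequalities; removing the
  vertices excludes the point with \<open>a = b\<close>, if there is one.\<close>

lemma Lam_in_eq:
  assumes "real (Suc (Suc k)) * tau \<le> alpha"
  shows "Lam_in lam (Suc k) = cell k - vertices lam (Suc k)"
proof -
  define p q q' where "p = real k * tau" and "q = real (Suc k) * tau" and "q' = alpha - tau"
  have pq: "0 \<le> p" "p < q" "q \<le> q'" "q' < alpha"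
    using assms mult_tau_nonneg[of k] tau_pos by (auto simp: p_def q_def q'_def algebra_simps)
  have V: "vertices lam (Suc k) = {meet lam q alpha, meet lam p alpha, meet lam p q', meet lam q q'}"
    unfolding vertices_eq[OF assms] p_def q_def q'_def ..
  have L: "Lam_in lam (Suc k) = convex hull (vertices lam (Suc k))
      - closed_segment (meet lam q alpha) (meet lam p alpha)
      - closed_segment (meet lam p alpha) (meet lam p q') - vertices lam (Suc k)"
    unfolding Lam_in_def using Qpt_0_Suc[OF assms] Qpt_0[OF assms] Qpt_1[OF assms]
    by (simp add: p_def q_def q'_def)
  have supp_V: "supp lam alpha v \<le> 1 \<and> supp lam p v \<le> 1 \<and> 1 \<le> supp lam q v \<and> 1 \<le> supp lam q' v"
    if "v \<in> vertices lam (Suc k)" for v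
  proof -
    have *: "supp lam alpha (meet lam a b) \<le> 1 \<and> supp lam p (meet lam a b) \<le> 1
        \<and> 1 \<le> supp lam q (meet lam a b) \<and> 1 \<le> supp lam q' (meet lam a b)"
      if ab: "a = p \<or> a = q" "b = q' \<or> b = alpha" for a b
    proof (intro conjI)
      have bnds: "p \<le> a" "a \<le> q" "q' \<le> b" "b \<le> alpha" using ab pq by auto
      show "1 \<le> supp lam q (meet lam a b)" "1 \<le> supp lam q' (meet lam a b)"
        using bnds pq angle_bounds by (intro supp_meet_ge_1; linarith)+
      show "supp lam alpha (meet lam a b) \<le> 1"
      proof (cases "b = alpha")
        case True
        then show ?thesis using supp_meet_eq_1(2)[of a b] bnds pq angle_bounds by simp
      next
        case False
        then have "supp lam alpha (meet lam a b) < 1"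
          using bnds pq angle_bounds by (intro supp_meet_less_1; linarith)
        then show ?thesis by simp
      qed
      show "supp lam p (meet lam a b) \<le> 1"
      proof (cases "a = p")
        case True
        then show ?thesis using supp_meet_eq_1(1)[of a b] bnds pq angle_bounds by simp
      next
        case False
        then have "supp lam p (meet lam a b) < 1"
          using bnds pq angle_bounds by (intro supp_meet_less_1; linarith)
        then show ?thesis by simp
      qed
    qed
    show ?thesis using that *[of q alpha] *[of p alpha] *[of p q'] *[of q q'] unfolding V by auto
  qed
  show ?thesis
  proof (intro equalityI subsetI)
    fix z assume "z \<in> Lam_in lam (Suc k)"
    then have z: "z \<in> convex hull (vertices lam (Suc k))" "z \<notin> vertices lam (Suc k)"
      "z \<notin> closed_segment (meet lam q alpha) (meet lam p alpha)"
      "z \<notin> closed_segment (meet lam p alpha) (meet lam p q')"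
      unfolding L by auto
    have "1 \<le> supp lam q z" "1 \<le> supp lam q' z" "supp lam p z \<le> 1" "supp lam alpha z \<le> 1"
      using supp_V by (auto intro!: supp_hull_bounds[OF z(1)])
    then obtain a b where ab: "z = meet lam a b" "p \<le> a" "a \<le> q" "q' \<le> b" "b \<le> alpha"
      using half_planes_imp_meet[of q z q' p alpha] pq by auto
    have "b \<noteq> alpha"
    proof
      assume "b = alpha"
      then have "z \<in> closed_segment (meet lam p alpha) (meet lam q alpha)"
        using meet_in_segment[of p a q alpha] ab pq angle_bounds by (simp add: meet_commute)
      then show False using z(3) by (simp add: closed_segment_commute)
    qed
    moreover have "a \<noteq> p"
    proof
      assume "a = p"
      then have "z \<in> closed_segment (meet lam p q') (meet lam p alpha)"
        using meet_in_segment[of q' b alpha p] ab pq angle_bounds by simp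
      then show False using z(4) by (simp add: closed_segment_commute)
    qed
    moreover have "a \<noteq> b"
    proof
      assume "a = b"
      then have "a = q" "b = q'" using ab pq by auto
      then show False using z(2) ab(1) unfolding V by simp
    qed
    ultimately have "z \<in> cell k"
      using cellI[of k a b] ab pq unfolding p_def q_def q'_def by simp
    then show "z \<in> cell k - vertices lam (Suc k)" using z(2) by simp
  next
    fix z assume z: "z \<in> cell k - vertices lam (Suc k)"
    then obtain a b where ab: "z = meet lam a b" "p < a" "a \<le> q" "a < b" "q' \<le> b" "b < alpha"
      unfolding p_def q_def q'_def by (elim DiffE cellE)
    have hull: "z \<in> convex hull (vertices lam (Suc k))"
      unfolding V ab(1) using ab pq angle_bounds by (intro meet_in_hull; linarith)
    have less: "supp lam p z < 1" "supp lam alpha z < 1"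
      unfolding ab(1) using ab pq angle_bounds by (intro supp_meet_less_1; linarith)+
    have "1 \<le> supp lam alpha w" if "w \<in> closed_segment (meet lam q alpha) (meet lam p alpha)" for w
      using that unfolding segment_convex_hull
    proof (rule supp_hull_bounds(1))
      fix v assume "v \<in> {meet lam q alpha, meet lam p alpha}"
      then show "1 \<le> supp lam alpha v"
        using supp_meet_eq_1(2)[of q alpha] supp_meet_eq_1(2)[of p alpha] pq angle_bounds by auto
    qed
    moreover have "1 \<le> supp lam p w" if "w \<in> closed_segment (meet lam p alpha) (meet lam p q')" for w
      using that unfolding segment_convex_hull
    proof (rule supp_hull_bounds(1))
      fix v assume "v \<in> {meet lam p alpha, meet lam p q'}"
      then show "1 \<le> supp lam p v"
        using supp_meet_eq_1(1)[of p alpha] supp_meet_eq_1(1)[of p q'] pq angle_bounds by auto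
    qed
    ultimately show "z \<in> Lam_in lam (Suc k)"
      unfolding L using hull less z by fastforce
  qed
qed

subsection \<open>The return map on a quadrilateral\<close>

lemma Lam_in_iff:
  assumes "real (Suc (Suc k)) * tau \<le> alpha"
  shows "z \<in> Lam_in lam (Suc k) \<longleftrightarrow> (\<exists>a b. z = meet lam a b \<and> real k * tau < a \<and> a \<le> real (Suc k) * tau
     \<and> a < b \<and> alpha - tau \<le> b \<and> b < alpha \<and> (a, b) \<noteq> (real (Suc k) * tau, alpha - tau))"
  unfolding Lam_in_eq[OF assms] cell_minus_vertices[OF assms] by (rule mem_Collect_eq)

text \<open>In coordinates the return map is an involution exchanging the roles of \<open>a\<close> and \<open>b\<close>; it fixes the vertex
  common to the two kept sides, so it permutes the remaining points.\<close>

lemma Lin_Lam_in: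
  assumes "real (Suc (Suc k)) * tau \<le> alpha"
  shows "Lin lam ` Lam_in lam (Suc k) = Lam_in lam (Suc k)"
proof -
  have maps: "Lin lam z \<in> Lam_in lam (Suc k) \<and> Lin lam (Lin lam z) = z"
    if z_in: "z \<in> Lam_in lam (Suc k)" for z
  proof -
    obtain a b where z: "z = meet lam a b" and ab: "real k * tau < a" "a \<le> real (Suc k) * tau"
      "a < b" "alpha - tau \<le> b" "b < alpha" and ne: "(a, b) \<noteq> (real (Suc k) * tau, alpha - tau)"
      using z_in unfolding Lam_in_iff[OF assms] by (elim exE conjE)
    define a' b' where "a' = alpha - b + real k * tau" and "b' = alpha - a + real k * tau"
    have step: "real (Suc k) * tau = real k * tau + tau"
      by (simp add: algebra_simps)
    have ab': "real k * tau < a'" "a' \<le> real (Suc k) * tau" "a' < b'" "alpha - tau \<le> b'" "b' < alpha"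
      using ab unfolding a'_def b'_def step by linarith+
    have ne': "(a', b') \<noteq> (real (Suc k) * tau, alpha - tau)"
      using ne unfolding a'_def b'_def step by auto
    have "Lin lam z = meet lam a' b'"
      unfolding z a'_def b'_def using ab by (rule Lin_meet)
    moreover have "Lin lam (meet lam a' b') = meet lam a b"
      using Lin_meet[OF ab'] by (simp add: a'_def b'_def)
    moreover have "meet lam a' b' \<in> Lam_in lam (Suc k)"
      unfolding Lam_in_iff[OF assms] using ab' ne' by (intro exI conjI) (rule refl)
    ultimately show ?thesis
      using z by simp
  qed
  show ?thesis
  proof (intro equalityI subsetI)
    fix w assume "w \<in> Lin lam ` Lam_in lam (Suc k)"
    then show "w \<in> Lam_in lam (Suc k)" using maps by (elim imageE) simp
  next
    fix z assume "z \<in> Lam_in lam (Suc k)"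
    then show "z \<in> Lin lam ` Lam_in lam (Suc k)"
      using maps[of z] by (intro image_eqI[of z "Lin lam" "Lin lam z"]) simp_all
  qed
qed

lemma meet_radial:
  "meet lam (m - d) (m + d) = centre lam + (1 / cos d) *\<^sub>R (kappa *\<^sub>R (cos m, cos (alpha - m)))"
proof -
  have "(m - d + (m + d)) / 2 = m" "(m + d - (m - d)) / 2 = d" by simp_all
  then show ?thesis
    unfolding meet_def centre_eq by simp
qed

text \<open>With the direction \<open>m\<close> fixed the point runs along a ray from the centre, at distance increasing with \<open>d\<close>.\<close>

lemma open_segment_radial:
  assumes "0 \<le> d0" "d0 < d1" "d1 < pi / 2"
  shows "open_segment (meet lam (m - d0) (m + d0)) (meet lam (m - d1) (m + d1))
    = {meet lam (m - d) (m + d) |d. d0 < d \<and> d < d1}"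
proof -
  define e where "e = kappa *\<^sub>R (cos m, cos (alpha - m))"
  define s0 s1 where "s0 = 1 / cos d0" and "s1 = 1 / cos d1"
  have cos_pos: "0 < cos d1" "cos d1 < cos d0" "cos d0 \<le> 1"
    using assms by (auto intro!: cos_gt_zero_pi cos_monotone_0_pi)
  have s: "1 \<le> s0" "s0 < s1"
    using cos_pos by (auto simp: s0_def s1_def field_simps)
  have radial: "meet lam (m - d) (m + d) = centre lam + (1 / cos d) *\<^sub>R e" for d
    unfolding e_def by (rule meet_radial)
  have ends: "meet lam (m - d0) (m + d0) = centre lam + s0 *\<^sub>R e"
    "meet lam (m - d1) (m + d1) = centre lam + s1 *\<^sub>R e"
    by (simp_all add: radial s0_def s1_def)
  have supp_m: "supp lam m (meet lam (m - d) (m + d)) = 1 / cos d" for d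
    by (simp add: supp_meet)
  have ne: "centre lam + s0 *\<^sub>R e \<noteq> centre lam + s1 *\<^sub>R e"
    using supp_m[of d0] supp_m[of d1] s unfolding ends s0_def[symmetric] s1_def[symmetric] by force
  have comb: "(1 - u) *\<^sub>R (centre lam + s0 *\<^sub>R e) + u *\<^sub>R (centre lam + s1 *\<^sub>R e)
      = centre lam + (s0 + u * (s1 - s0)) *\<^sub>R e" for u
    by (simp add: algebra_simps)
  show ?thesis
    unfolding ends
  proof (intro equalityI subsetI)
    fix z assume "z \<in> open_segment (centre lam + s0 *\<^sub>R e) (centre lam + s1 *\<^sub>R e)"
    then obtain u where u: "0 < u" "u < 1" and z: "z = centre lam + (s0 + u * (s1 - s0)) *\<^sub>R e"
      unfolding in_segment comb by (elim conjE exE)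
    define t where "t = s0 + u * (s1 - s0)"
    have "0 < u * (s1 - s0)" "u * (s1 - s0) < 1 * (s1 - s0)"
      using u s by (auto intro!: mult_strict_right_mono simp del: mult_1)
    then have t: "s0 < t" "t < s1" by (auto simp: t_def)
    have "0 < t" using t s by simp
    then have inv: "cos d1 < 1 / t" "1 / t < cos d0"
      using t cos_pos by (auto simp: s0_def s1_def field_simps)
    define d where "d = arccos (1 / t)"
    have range: "-1 \<le> 1 / t" "1 / t \<le> 1"
      using inv cos_pos by linarith+
    have cos_d: "cos d = 1 / t"
      unfolding d_def using range by (rule cos_arccos)
    have d: "0 \<le> d" "d \<le> pi"
      unfolding d_def using range by (auto intro!: arccos_lbound arccos_ubound)
    have "d0 < d"
      using cos_monotone_0_pi_le[of d d0] d assms inv cos_d by force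
    moreover have "d < d1"
      using cos_monotone_0_pi_le[of d1 d] d assms inv cos_d by force
    moreover have "z = meet lam (m - d) (m + d)"
      using t s by (simp add: radial cos_d z flip: t_def)
    ultimately show "z \<in> {meet lam (m - d) (m + d) |d. d0 < d \<and> d < d1}"
      by (intro CollectI exI conjI)
  next
    fix z assume "z \<in> {meet lam (m - d) (m + d) |d. d0 < d \<and> d < d1}"
    then obtain d where d: "d0 < d" "d < d1" and z: "z = meet lam (m - d) (m + d)"
      by (elim CollectE exE conjE)
    define t where "t = 1 / cos d"
    define u where "u = (t - s0) / (s1 - s0)"
    have "0 < cos d" "cos d1 < cos d" "cos d < cos d0"
      using d assms by (auto intro!: cos_gt_zero_pi cos_monotone_0_pi)
    then have "s0 < t" "t < s1"
      using cos_pos by (auto simp: s0_def s1_def t_def field_simps)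
    then have "0 < u" "u < 1" "s0 + u * (s1 - s0) = 1 / cos d"
      by (simp_all add: u_def t_def[symmetric])
    then show "z \<in> open_segment (centre lam + s0 *\<^sub>R e) (centre lam + s1 *\<^sub>R e)"
      unfolding in_segment comb z radial using ne by (intro conjI exI[of _ u]) simp_all
  qed
qed

text \<open>A fixed point satisfies \<open>a + b = \<alpha> + k\<tau>\<close>, so it lies on one ray from the centre, and the two opposite
  vertices are on that ray as well.\<close>

lemma fixed_points_Lam_in:
  assumes k: "real (Suc (Suc k)) * tau \<le> alpha"
  shows "{z \<in> Lam_in lam (Suc k). Lin lam z = z} = open_segment (Qpt lam 1 (Suc k)) (Qpt lam 0 k)"
proof -
  define m d0 d1 where "m = (alpha + real k * tau) / 2"
    and "d0 = (alpha - real (Suc (Suc k)) * tau) / 2" and "d1 = (alpha - real k * tau) / 2"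
  have step: "real (Suc k) * tau = real k * tau + tau" "real (Suc (Suc k)) * tau = real k * tau + 2 * tau"
    by (simp_all add: algebra_simps)
  have corners: "m - d0 = real (Suc k) * tau" "m + d0 = alpha - tau" "m - d1 = real k * tau" "m + d1 = alpha"
    unfolding m_def d0_def d1_def step by (simp_all add: field_simps)
  have d: "0 \<le> d0" "d0 < d1" "d1 < pi / 2"
  proof -
    define x where "x = real k * tau"
    have "0 \<le> x" "x + 2 * tau \<le> alpha"
      using k mult_tau_nonneg[of k] unfolding step x_def by simp_all
    then show "0 \<le> d0" "d0 < d1" "d1 < pi / 2"
      using angle_bounds unfolding step d0_def d1_def x_def[symmetric] by (simp_all add: field_simps)
  qed
  have "open_segment (Qpt lam 1 (Suc k)) (Qpt lam 0 k) = {meet lam (m - d) (m + d) |d. d0 < d \<and> d < d1}"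
    using open_segment_radial[OF d, of m] unfolding Qpt_1_Suc[OF k] Qpt_0[OF k] corners .
  also have "\<dots> = {z \<in> Lam_in lam (Suc k). Lin lam z = z}"
  proof (intro equalityI subsetI)
    fix z assume "z \<in> {meet lam (m - d) (m + d) |d. d0 < d \<and> d < d1}"
    then obtain d where z: "z = meet lam (m - d) (m + d)" and "d0 < d" "d < d1"
      by (elim CollectE exE conjE)
    then have ab: "real k * tau < m - d" "m - d \<le> real (Suc k) * tau" "m - d < m + d"
      "alpha - tau \<le> m + d" "m + d < alpha" "(m - d, m + d) \<noteq> (real (Suc k) * tau, alpha - tau)"
      using d(1) corners by auto
    have "alpha - (m + d) + real k * tau = m - d" "alpha - (m - d) + real k * tau = m + d"
      by (simp_all add: m_def field_simps)
    note eq = this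
    have "Lin lam z = z"
      using Lin_meet[OF ab(1-5)] unfolding z eq .
    moreover have "z \<in> Lam_in lam (Suc k)"
      unfolding Lam_in_iff[OF k] using z ab by (intro exI conjI)
    ultimately show "z \<in> {z \<in> Lam_in lam (Suc k). Lin lam z = z}"
      by simp
  next
    fix z assume "z \<in> {z \<in> Lam_in lam (Suc k). Lin lam z = z}"
    then have z_in: "z \<in> Lam_in lam (Suc k)" and fixed: "Lin lam z = z" by simp_all
    obtain a b where z: "z = meet lam a b" and ab: "real k * tau < a" "a \<le> real (Suc k) * tau"
      "a < b" "alpha - tau \<le> b" "b < alpha" and ne: "(a, b) \<noteq> (real (Suc k) * tau, alpha - tau)"
      using z_in unfolding Lam_in_iff[OF k] by (elim exE conjE)
    have eq: "meet lam (alpha - b + real k * tau) (alpha - a + real k * tau) = meet lam a b"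
      using Lin_meet[OF ab] fixed z by simp
    have a: "alpha - b + real k * tau = a"
      using mult_tau_nonneg[of k] ab k angle_bounds unfolding step
      by (intro meet_inj(1)[OF eq]; linarith)
    define d where "d = (b - a) / 2"
    have m: "a = m - d" "b = m + d"
      unfolding m_def d_def using a by (simp_all add: field_simps)
    have "d \<noteq> d0"
      using ne corners unfolding m by auto
    moreover have "m + d < m + d1"
      unfolding corners m(2)[symmetric] by (rule ab(5))
    moreover have "m - d \<le> m - d0"
      unfolding corners m(1)[symmetric] by (rule ab(2))
    ultimately have "d0 < d" "d < d1" by simp_all
    then show "z \<in> {meet lam (m - d) (m + d) |d. d0 < d \<and> d < d1}"
      using z unfolding m by (intro CollectI exI conjI)
  qed
  finally show ?thesis by (rule sym)
qed

section \<open>Measure of the remaining atoms\<close>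

lemma continuous_supp: "continuous_on S (supp lam psi)"
  unfolding supp_def by (intro continuous_intros) (use kappa_pos sin_alpha_pos in auto)

text \<open>The interval \<open>[a, b]\<close> lies above \<open>psi\<close> if it does not contain \<open>psi\<close> and its midpoint \<open>m\<close> satisfies
  \<open>sin (m - psi) > 0\<close>. This expresses \<open>psi < a\<close> by two open half-planes.\<close>

lemma sector_left_tangent_iff:
  assumes "0 < a" "a < b" "b < alpha" "0 \<le> psi" "psi < pi"
  shows "psi < a \<longleftrightarrow> supp lam psi (meet lam a b) < 1 \<and> 0 < supp lam (psi + pi / 2) (meet lam a b)"
proof -
  define m where "m = (a + b) / 2"
  have m: "a < m" "m < b" using assms by (simp_all add: m_def)
  have "0 < cos ((b - a) / 2)"
    using assms angle_bounds by (intro cos_gt_zero_pi; simp add: field_simps)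
  moreover have "cos (psi + pi / 2 - m) = sin (m - psi)"
    by (simp add: cos_diff cos_add sin_add sin_diff)
  ultimately have side: "0 < supp lam (psi + pi / 2) (meet lam a b) \<longleftrightarrow> 0 < sin (m - psi)"
    unfolding supp_meet m_def[symmetric] by (simp add: zero_less_divide_iff)
  show ?thesis
  proof
    assume "psi < a"
    moreover have "0 < sin (m - psi)"
      using \<open>psi < a\<close> m assms angle_bounds by (intro sin_gt_zero) auto
    moreover have "supp lam psi (meet lam a b) < 1"
      using \<open>psi < a\<close> assms angle_bounds by (intro supp_meet_less_1; linarith)
    ultimately show "supp lam psi (meet lam a b) < 1 \<and> 0 < supp lam (psi + pi / 2) (meet lam a b)"
      using side by simp
  next
    assume *: "supp lam psi (meet lam a b) < 1 \<and> 0 < supp lam (psi + pi / 2) (meet lam a b)"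
    show "psi < a"
    proof (rule ccontr)
      assume "\<not> psi < a"
      then have "b < psi"
        using * supp_meet_ge_1[of a psi b] assms angle_bounds by force
      then have "0 \<le> sin (psi - m)"
        using m assms angle_bounds by (intro sin_ge_zero) auto
      then have "sin (m - psi) \<le> 0"
        using sin_minus[of "psi - m"] by simp
      then show False using * side by simp
    qed
  qed
qed

lemma open_Sector: "open (Sector lam)"
proof -
  have "closed {z. Qform lam (z - centre lam) (z - centre lam) \<le> radius2 lam}"
    unfolding Qform_def by (intro closed_Collect_le continuous_intros)
  then show ?thesis
    unfolding Sector_def by (intro open_Diff open_interior)
qed

text \<open>By \<open>sector_left_tangent_iff\<close> and its mirror image under \<open>G\<close> the cell is a Boolean combination of open sets.\<close>

lemma cell_measurable: "cell k \<in> lmeasurable"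
proof (cases "k \<le> NN lam")
  case False
  then show ?thesis using cell_empty by simp
next
  case True
  \<comment> \<open>right psi cuts out psi < a, and low cuts out b < alpha - tau.\<close>
  define right where "right psi = {z. supp lam psi z < 1} \<inter> {z. 0 < supp lam (psi + pi / 2) z}" for psi
  define low where "low = {z. supp lam tau (G z) < 1} \<inter> {z. 0 < supp lam (tau + pi / 2) (G z)}"
  have cont_G: "continuous_on S (\<lambda>z. supp lam psi (G z))" for S psi
    unfolding supp_G by (rule continuous_supp)
  have open_right: "open (right psi)" for psi
    unfolding right_def by (intro open_Int open_Collect_less continuous_supp continuous_intros)
  have open_low: "open low"
    unfolding low_def by (intro open_Int open_Collect_less cont_G continuous_intros)
  have "real k * tau \<le> real (NN lam) * tau"
    using True tau_pos by (intro mult_right_mono) auto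
  then have "real k * tau \<le> alpha"
    using NN_le by linarith
  moreover have step: "real (Suc k) * tau = real k * tau + tau"
    by (simp add: algebra_simps)
  ultimately have range: "0 \<le> real k * tau" "real k * tau < pi" "0 \<le> real (Suc k) * tau" "real (Suc k) * tau < pi"
    using mult_tau_nonneg[of k] angle_bounds four_alpha unfolding step by linarith+
  have right: "meet lam a b \<in> right psi \<longleftrightarrow> psi < a"
    if "0 < a" "a < b" "b < alpha" "0 \<le> psi" "psi < pi" for a b psi
    using sector_left_tangent_iff[OF that] by (simp add: right_def)
  have low: "meet lam a b \<in> low \<longleftrightarrow> b < alpha - tau" if "0 < a" "a < b" "b < alpha" for a b
    using sector_left_tangent_iff[of "alpha - b" "alpha - a" tau] that angle_bounds
    unfolding low_def by (auto simp: G_meet)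
  have "cell k = Sector lam \<inter> right (real k * tau) - right (real (Suc k) * tau) - low"
  proof (intro equalityI subsetI)
    fix z assume "z \<in> cell k"
    then obtain a b where z: "z = meet lam a b" and ab: "real k * tau < a" "a \<le> real (Suc k) * tau" "a < b"
      "alpha - tau \<le> b" "b < alpha"
      by (rule cellE)
    have a: "0 < a" using ab range by linarith
    show "z \<in> Sector lam \<inter> right (real k * tau) - right (real (Suc k) * tau) - low"
    proof (intro DiffI IntI)
      show "z \<in> Sector lam"
        unfolding z using a ab(3,5) by (rule meet_in_Sector)
      show "z \<in> right (real k * tau)"
        using right[OF a ab(3,5) range(1,2)] ab(1) z by blast
      show "z \<notin> right (real (Suc k) * tau)"
        using right[OF a ab(3,5) range(3,4)] ab(2) z not_less by blast
      show "z \<notin> low"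
        using low[OF a ab(3,5)] ab(4) z not_less by blast
    qed
  next
    fix z assume *: "z \<in> Sector lam \<inter> right (real k * tau) - right (real (Suc k) * tau) - low"
    then have "z \<in> Sector lam" by blast
    then obtain a b where z: "z = meet lam a b" and ab: "0 < a" "a < b" "b < alpha"
      unfolding Sector_eq by (elim CollectE exE conjE)
    have "real k * tau < a"
      using * right[OF ab range(1,2)] z by blast
    moreover have "a \<le> real (Suc k) * tau"
      using * right[OF ab range(3,4)] z not_less by blast
    moreover have "alpha - tau \<le> b"
      using * low[OF ab] z not_less by blast
    ultimately show "z \<in> cell k"
      unfolding z using ab(2,3) by (intro cellI)
  qed
  moreover have "Sector lam \<inter> right (real k * tau) - right (real (Suc k) * tau) - low \<in> sets lebesgue"
  proof -
    have open_sets: "S \<in> sets lebesgue" if "open S" for S :: "plane set"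
      using that by (simp add: borel_open)
    show ?thesis
      by (intro sets.Diff sets.Int open_sets open_Sector open_right open_low)
  qed
  moreover have "bounded (cell k)"
  proof (rule bounded_subset)
    show "bounded ({1 / 2<..<1::real} \<times> {1 / 2<..<1::real})"
      by (intro bounded_Times) auto
    show "cell k \<subseteq> {1 / 2<..<1} \<times> {1 / 2<..<1}"
    proof
      fix z assume "z \<in> cell k"
      then obtain a b where z: "z = meet lam a b" and ab: "real k * tau < a" "a < b" "b < alpha"
        by (rule cellE)
      then show "z \<in> {1 / 2<..<1} \<times> {1 / 2<..<1}"
        unfolding z using range by (intro meet_in_corner) auto
    qed
  qed
  ultimately show ?thesis
    by (metis bounded_set_imp_lmeasurable)
qed

text \<open>The line \<open>y = 1\<close> is tangent to the ellipse at \<open>T0\<close>, so y differs from 1 by a term quadratic in the angular distance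
  \<open>p\<close> to \<open>T0\<close>, while x varies linearly. The bound on \<open>\<tau>\<close> keeps \<open>cos d\<close> above \<open>1/2\<close>.\<close>

lemma meet_near_T0:
  assumes "0 < a" "alpha - 2 * tau < a" "a < b" "b < alpha" "tau \<le> 1 / 2"
  shows "meet lam a b \<in> cbox (1 - kappa + kappa * cos alpha - 2 * tau\<^sup>2, 1 - 2 * tau\<^sup>2)
     (1 - kappa + kappa * cos alpha + 4 * tau, 1)"
proof -
  define m d where "m = (a + b) / 2" and "d = (b - a) / 2"
  define p where "p = alpha - m"
  have p: "0 < d" "d < p" "d < tau" "p < 2 * tau" "p < pi" "d < pi / 2"
    using assms angle_bounds by (auto simp: p_def m_def d_def field_simps)
  have cd: "1 / 2 \<le> cos d" "cos d \<le> 1"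
    using p assms(5) pi_gt3 cos_monotone_0_pi_le[of d "pi / 3"] by (auto simp: cos_60)
  have cp: "1 - 2 * tau\<^sup>2 \<le> cos p"
  proof -
    have "\<bar>sin (p / 2)\<bar> \<le> \<bar>tau\<bar>"
      using abs_sin_x_le_abs_x[of "p / 2"] p by simp
    then have "(sin (p / 2))\<^sup>2 \<le> tau\<^sup>2"
      by (simp add: abs_le_square_iff)
    then show ?thesis
      using cos_double_sin[of "p / 2"] by simp
  qed
  define Y where "Y = cos p / cos d"
  have "cos p < cos d"
    using p by (intro cos_less_cos) auto
  then have Y: "Y < 1" using cd by (simp add: Y_def)
  have Y': "1 - 2 * tau\<^sup>2 \<le> Y"
  proof -
    have "0 \<le> cos p"
      using p assms(5) pi_gt3 by (intro cos_ge_zero) auto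
    then have "cos p * cos d \<le> cos p" using cd by (simp add: mult_left_le)
    then have "cos p \<le> Y" using cd by (simp add: Y_def pos_le_divide_eq)
    then show ?thesis using cp by simp
  qed
  define X where "X = cos m / cos d"
  have X_eq: "X = cos alpha * Y + sin alpha * (sin p / cos d)"
  proof -
    have "cos m = cos (alpha - p)" by (simp add: p_def)
    then show ?thesis
      by (simp add: X_def Y_def cos_diff add_divide_distrib)
  qed
  have sp: "0 \<le> sin p / cos d" "sin p / cos d \<le> 4 * tau"
  proof -
    show "0 \<le> sin p / cos d"
      using p cd by (auto intro!: divide_nonneg_nonneg sin_ge_zero)
    have "sin p \<le> 2 * tau"
      using abs_sin_x_le_abs_x[of p] p by simp
    moreover have "2 * tau \<le> 4 * tau * cos d"
      using cd tau_pos by simp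
    ultimately show "sin p / cos d \<le> 4 * tau"
      using cd by (simp add: divide_le_eq)
  qed
  have ca: "0 \<le> cos alpha" "cos alpha \<le> 1"
    using lam_pos lam_less_1 by (auto simp: cos_alpha)
  have sa: "0 \<le> sin alpha" "sin alpha \<le> 1"
    using sin_alpha_pos by auto
  have "X \<le> cos alpha + 4 * tau"
  proof -
    have "cos alpha * Y \<le> cos alpha * 1"
      using ca Y by (intro mult_left_mono) auto
    moreover have "sin alpha * (sin p / cos d) \<le> 1 * (4 * tau)"
      using sa sp by (intro mult_mono) auto
    ultimately show ?thesis unfolding X_eq by simp
  qed
  moreover have "cos alpha - 2 * tau\<^sup>2 \<le> X"
  proof -
    have "cos alpha * (1 - Y) \<le> 1 * (2 * tau\<^sup>2)"
      using ca Y Y' by (intro mult_mono) auto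
    moreover have "0 \<le> sin alpha * (sin p / cos d)"
      using sa(1) sp(1) by (rule mult_nonneg_nonneg)
    ultimately show ?thesis unfolding X_eq by (simp add: algebra_simps)
  qed
  ultimately have X: "kappa * X \<le> kappa * (cos alpha + 4 * tau)" "kappa * (cos alpha - 2 * tau\<^sup>2) \<le> kappa * X"
    using kappa_pos by simp_all
  have "kappa * Y \<le> kappa * 1" "kappa * (1 - 2 * tau\<^sup>2) \<le> kappa * Y"
    using kappa_pos Y Y' by simp_all
  moreover have "kappa * tau \<le> 1 * tau" "kappa * tau\<^sup>2 \<le> 1 * tau\<^sup>2"
    using kappa_pos kappa_less tau_pos by (auto intro!: mult_right_mono simp del: mult_1)
  moreover have "meet lam a b = (1 - kappa + kappa * X, 1 - kappa + kappa * Y)"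
    by (simp add: meet_def X_def Y_def p_def m_def d_def)
  ultimately show ?thesis
    using X by (simp add: algebra_simps)
qed

lemma measure_late_cell:
  assumes "NN lam \<le> Suc k" "tau \<le> 1 / 2"
  shows "Qarea lam (cell k) \<le> 12 * tau ^ 3"
proof -
  define B where "B = cbox (1 - kappa + kappa * cos alpha - 2 * tau\<^sup>2, 1 - 2 * tau\<^sup>2)
     (1 - kappa + kappa * cos alpha + 4 * tau, 1)"
  have "alpha < real (Suc (Suc k)) * tau"
  proof -
    have "real (Suc (NN lam)) * tau \<le> real (Suc (Suc k)) * tau"
      using assms tau_pos by (intro mult_right_mono) auto
    then show ?thesis using less_NN by linarith
  qed
  then have "alpha - 2 * tau < real k * tau"
    by (simp add: algebra_simps)
  moreover have "z \<in> B" if "alpha - 2 * tau < real k * tau" "z \<in> cell k" for z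
    using that(2)
  proof (rule cellE)
    fix a b assume "z = meet lam a b" "real k * tau < a" "a < b" "b < alpha"
    then show "z \<in> B"
      unfolding B_def using that(1) mult_tau_nonneg[of k] assms(2)
      by (simp only:) (rule meet_near_T0; linarith)
  qed
  ultimately have "cell k \<subseteq> B" by blast
  then have "measure lebesgue (cell k) \<le> measure lebesgue B"
    using cell_measurable by (intro measure_mono_fmeasurable) (auto simp: B_def fmeasurableD)
  also have "\<dots> = (4 * tau + 2 * tau\<^sup>2) * (2 * tau\<^sup>2)"
  proof -
    have "- tau\<^sup>2 \<le> 2 * tau"
      using tau_pos zero_le_power2[of tau] by linarith
    then show ?thesis by (simp add: B_def content_Pair)
  qed
  also have "\<dots> \<le> (6 * tau) * (2 * tau\<^sup>2)"
    using tau_pos assms(2) by (intro mult_right_mono) (simp_all add: power2_eq_square mult_left_le)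
  also have "\<dots> = 12 * tau ^ 3"
    by (simp add: power2_eq_square power3_eq_cube)
  finally have "measure lebesgue (cell k) \<le> 12 * tau ^ 3" .
  moreover have "sqrt (1 - lam\<^sup>2 / 4) \<le> 1" by simp
  ultimately have "sqrt (1 - lam\<^sup>2 / 4) * measure lebesgue (cell k) \<le> 1 * (12 * tau ^ 3)"
    using lam_less_1 lam_pos by (intro mult_mono) (auto simp: power2_eq_square mult_le_one)
  then show ?thesis by (simp add: Qarea_def)
qed

text \<open>Here \<open>\<tau> = 4x\<close> with \<open>sin x = \<lambda>/2\<close>, and \<open>sin x \<ge> x/2\<close> on \<open>[0, \<pi>/3]\<close>.\<close>

lemma tau_le: "tau \<le> 4 * lam"
proof -
  define x where "x = tau / 4"
  have x: "x = pi / 2 - alpha" "0 < x" "x < pi / 3"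
    using angle_bounds by (auto simp: x_def drift_def)
  have "sin x = lam / 2"
    unfolding x(1) by (simp add: sin_diff cos_alpha)
  moreover have "x / 2 \<le> sin x"
  proof -
    obtain y where y: "0 < y" "y < x" "sin x - sin 0 = (x - 0) * cos y"
      using MVT2[of 0 x sin cos] x(2) by (auto intro: DERIV_sin)
    have "cos (pi / 3) \<le> cos y"
      using x y by (intro cos_monotone_0_pi_le) auto
    then have "x * (1 / 2) \<le> x * cos y"
      using x(2) by (intro mult_left_mono) (auto simp: cos_60)
    then show ?thesis using y by simp
  qed
  ultimately show ?thesis by (simp add: x_def)
qed

lemma is_Lam_in_cell:
  assumes "n \<in> {1..NN lam - 1}"
  shows "real (Suc (Suc (n - 1))) * tau \<le> alpha" "is_Lam_in lam n (cell (n - 1))" "cell (n - 1) \<in> atoms lam"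
proof -
  have n: "n = Suc (n - 1)" "Suc (Suc (n - 1)) \<le> NN lam" using assms by auto
  have "real (Suc (Suc (n - 1))) * tau \<le> real (NN lam) * tau"
    using n(2) tau_pos by (intro mult_right_mono) auto
  then show *: "real (Suc (Suc (n - 1))) * tau \<le> alpha"
    using NN_le by linarith
  then show "is_Lam_in lam n (cell (n - 1))"
    unfolding is_Lam_in_def using Lam_in_eq[OF *] n(1) by simp
  define k x where "k = n - 1" and "x = real k * tau"
  have "real (Suc k) * tau = x + tau" "x + 2 * tau \<le> alpha"
    using * unfolding k_def[symmetric] by (simp_all add: x_def algebra_simps)
  then have "meet lam (x + tau / 2) (alpha - tau / 2) \<in> cell (n - 1)"
    unfolding k_def[symmetric] using tau_pos by (intro cellI; (unfold x_def[symmetric])?; linarith)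
  then show "cell (n - 1) \<in> atoms lam"
    unfolding atoms_eq by blast
qed

text \<open>The cells before these are the quadrilaterals, the ones after are empty.\<close>

lemma other_atoms_subset: "other_atoms lam \<subseteq> cell ` {NN lam - 1, NN lam}"
proof
  fix A assume "A \<in> other_atoms lam"
  then have A: "A \<in> atoms lam" and other: "\<not> (\<exists>n\<in>{1..NN lam - 1}. is_Lam_in lam n A)"
    by (simp_all add: other_atoms_def)
  obtain k where k: "A = cell k" "cell k \<noteq> {}"
    using A unfolding atoms_eq by (elim CollectE exE conjE)
  have "k \<le> NN lam"
    using cell_empty[of k] k(2) by (cases "NN lam < k") auto
  moreover have "Suc k \<notin> {1..NN lam - 1}"
  proof
    assume "Suc k \<in> {1..NN lam - 1}"
    then have "is_Lam_in lam (Suc k) A"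
      using is_Lam_in_cell(2)[of "Suc k"] k(1) by simp
    then show False using other \<open>Suc k \<in> {1..NN lam - 1}\<close> by fast
  qed
  ultimately have "k = NN lam - 1 \<or> k = NN lam" by auto
  then show "A \<in> cell ` {NN lam - 1, NN lam}"
    using k(1) by fast
qed

lemma finite_other_atoms: "finite (other_atoms lam)" "card (other_atoms lam) \<le> 2"
proof -
  have fin: "finite (cell ` {NN lam - 1, NN lam})" by simp
  show "finite (other_atoms lam)"
    using other_atoms_subset fin by (rule finite_subset)
  have "card (other_atoms lam) \<le> card (cell ` {NN lam - 1, NN lam})"
    using fin other_atoms_subset by (rule card_mono)
  also have "\<dots> \<le> card {NN lam - 1, NN lam}"
    by (rule card_image_le) simp
  also have "\<dots> \<le> 2" by (simp add: card_insert_if)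
  finally show "card (other_atoms lam) \<le> 2" .
qed

lemma sum_Qarea_other_atoms:
  assumes "lam \<le> 1 / 8"
  shows "\<bar>\<Sum>A\<in>other_atoms lam. Qarea lam A\<bar> \<le> 1536 * lam ^ 3"
proof -
  have "lam\<^sup>2 \<le> 1"
    using lam_pos lam_less_1 by (simp add: power_le_one)
  then have "0 \<le> 1 - lam\<^sup>2 / 4" by simp
  then have nonneg: "0 \<le> Qarea lam A" for A
    by (simp add: Qarea_def)
  have "tau \<le> 1 / 2" using tau_le assms by simp
  have le: "Qarea lam A \<le> 12 * tau ^ 3" if "A \<in> other_atoms lam" for A
  proof -
    have "A \<in> cell ` {NN lam - 1, NN lam}"
      using other_atoms_subset that by (rule subsetD)
    then obtain k where "A = cell k" "NN lam \<le> Suc k" by auto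
    then show ?thesis using measure_late_cell \<open>tau \<le> 1 / 2\<close> by simp
  qed
  have "(\<Sum>A\<in>other_atoms lam. Qarea lam A) \<le> real (card (other_atoms lam)) * (12 * tau ^ 3)"
    using le by (rule sum_bounded_above)
  \<comment> \<open>Two atoms at most, with drift at most 4 lam.\<close>
  also have "\<dots> \<le> 2 * (12 * (4 * lam) ^ 3)"
    using finite_other_atoms(2) tau_le tau_pos by (intro mult_mono power_mono) auto
  also have "\<dots> = 1536 * lam ^ 3"
    by (simp add: power_mult_distrib)
  finally show ?thesis
    using sum_nonneg[of "other_atoms lam" "Qarea lam"] nonneg by simp
qed

end

section \<open>All parameters together\<close>

lemma rotation_parameterI:
  assumes "0 < lam" "lam < 2 * cos (4 * pi / 9)"
  shows "rotation lam"
proof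
  have "cos (4 * pi / 9) < cos (pi / 3)"
    using pi_gt_zero by (intro cos_monotone_0_pi) auto
  then show "lam < 1" using assms(2) by (simp add: cos_60)
qed (fact assms(1))

theorem theorem6:
  shows "(\<forall>lam::real. 0 < lam \<and> lam < 2 * cos (4 * pi / 9) \<longrightarrow>
      (\<forall>n\<in>{1..NN lam - 1}.
          (\<exists>A\<in>atoms lam. is_Lam_in lam n A) \<and>
          Lin lam ` Lam_in lam n = Lam_in lam n \<and>
          (\<forall>z\<in>Lam_in lam n. transit lam z = 4 * (n - 1) \<and>
             ret_word lam z = replicate (4 * (n - 1)) 1) \<and>
          {z \<in> Lam_in lam n. Lin lam z = z} = open_segment (Qpt lam 1 n) (Qpt lam 0 (n - 1))) \<and>
      finite (other_atoms lam) \<and> card (other_atoms lam) \<le> 5 \<and>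
      (\<forall>A\<in>other_atoms lam. A \<in> lmeasurable)) \<and>
    (\<lambda>lam. \<Sum>A\<in>other_atoms lam. Qarea lam A) \<in> O[at_right 0](\<lambda>lam. lam ^ 3)"
proof (intro conjI allI impI ballI)
  fix lam :: real assume lam: "0 < lam \<and> lam < 2 * cos (4 * pi / 9)"
  then interpret rotation lam by (intro rotation_parameterI) auto
  show "finite (other_atoms lam)" by (rule finite_other_atoms)
  show "card (other_atoms lam) \<le> 5" using finite_other_atoms(2) by simp
  show "A \<in> lmeasurable" if A: "A \<in> other_atoms lam" for A
  proof -
    have "A \<in> cell ` {NN lam - 1, NN lam}"
      using other_atoms_subset A by (rule subsetD)
    then show ?thesis using cell_measurable by auto
  qed
  fix n assume n: "n \<in> {1..NN lam - 1}"
  define k where "k = n - 1"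
  have nk: "n = Suc k" and k: "real (Suc (Suc k)) * tau \<le> alpha"
    using n is_Lam_in_cell(1)[OF n] by (auto simp: k_def)
  show "\<exists>A\<in>atoms lam. is_Lam_in lam n A"
    using is_Lam_in_cell(2,3)[OF n] by blast
  show "Lin lam ` Lam_in lam n = Lam_in lam n"
    unfolding nk using k by (rule Lin_Lam_in)
  show "{z \<in> Lam_in lam n. Lin lam z = z} = open_segment (Qpt lam 1 n) (Qpt lam 0 (n - 1))"
    using fixed_points_Lam_in[OF k] unfolding nk by simp
  fix z assume "z \<in> Lam_in lam n"
  then have "z \<in> cell k"
    unfolding nk Lam_in_eq[OF k] by simp
  then show "transit lam z = 4 * (n - 1)" "ret_word lam z = replicate (4 * (n - 1)) 1"
    unfolding nk by (auto elim!: cellE simp: transit_meet ret_word_meet)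
next
  have "eventually (\<lambda>lam::real. lam \<in> {0<..<1 / 8}) (at_right 0)"
    by (rule eventually_at_right_real) simp
  then have "eventually (\<lambda>lam::real. norm (\<Sum>A\<in>other_atoms lam. Qarea lam A) \<le> 1536 * norm (lam ^ 3)) (at_right 0)"
  proof eventually_elim
    case (elim lam)
    then interpret rotation lam by unfold_locales auto
    show ?case
      using sum_Qarea_other_atoms elim by simp
  qed
  then show "(\<lambda>lam. \<Sum>A\<in>other_atoms lam. Qarea lam A) \<in> O[at_right 0](\<lambda>lam. lam ^ 3)"
    by (rule bigoI)
qed

end
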